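(* Let $K$ be an algebraically closed field of characteristic different from $2$ and $3$. Any non-associative (i.e. not associative) Jacobi-Jordan algebra of dimension $6$ over $K$ is isomorphic to exactly one of the following $5$ algebras, each given by a basis $(e_1,\ldots,e_6)$ and the listed products: \begin{itemize} \item $A_{1,6}$, with $\dim A^2=4$: $e_1\cdot e_1=e_2$, $e_1\cdot e_3=e_3\cdot e_1=e_5$, $e_1\cdot e_4=e_4\cdot e_1=e_6$, $e_3\cdot e_3=e_4$, $e_3\cdot e_5=e_5\cdot e_3=-\tfrac12 e_6$; \item $A_{2,6}(\beta,\delta)$ with $\beta,\delta\in\{0,1\}$ (four algebras), each with $\dim A^2=3$: $e_1\cdot e_1=e_2$, $e_1\cdot e_3=e_3\cdot e_1=-\beta e_2$, $e_1\cdot e_4=e_4\cdot e_1=e_5$, $e_1\cdot e_5=e_5\cdot e_1=-\tfrac12 e_6$, $e_2\cdot e_4=e_4\cdot e_2=e_6$, $e_3\cdot e_3=\delta e_6$, $e_3\cdot e_5=e_5\cdot e_3=\beta e_6$. \end{itemize}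
   Context: An algebra over a field $K$ is a $K$-vector space with a bilinear product $x\cdot y$; neither associativity nor a unit is assumed. A Jacobi-Jordan algebra is an algebra $A$ over $K$ satisfying $x\cdot y=y\cdot x$ and $x\cdot(y\cdot z)+y\cdot(z\cdot x)+z\cdot(x\cdot y)=0$ for all $x,y,z\in A$. $A^2$ denotes the linear span of all products $a\cdot b$ with $a,b\in A$. Products of basis vectors that are not listed are zero. *)

theory Defs
  imports "HOL-Analysis.Cartesian_Space" "HOL-Computational_Algebra.Polynomial"
begin

locale bilinear_algebra = vector_space smul
  for smul :: "'k::field \<Rightarrow> 'a::ab_group_add \<Rightarrow> 'a" +
  fixes mul :: "'a \<Rightarrow> 'a \<Rightarrow> 'a"
  assumes linear_left: "Vector_Spaces.linear smul smul (\<lambda>x. mul x y)"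
    and linear_right: "Vector_Spaces.linear smul smul (\<lambda>y. mul x y)"

locale jacobi_jordan_algebra = bilinear_algebra +
  assumes mul_commute: "mul x y = mul y x"
    and jacobi: "mul x (mul y z) + mul y (mul z x) + mul z (mul x y) = 0"

definition associative :: "('a \<Rightarrow> 'a \<Rightarrow> 'a) \<Rightarrow> bool"
  where "associative mul \<longleftrightarrow> (\<forall>x y z. mul (mul x y) z = mul x (mul y z))"

definition algebra_square ::
    "('k::field \<Rightarrow> 'a::ab_group_add \<Rightarrow> 'a) \<Rightarrow> ('a \<Rightarrow> 'a \<Rightarrow> 'a) \<Rightarrow> 'a set"
  where "algebra_square smul mul = module.span smul {mul a b |a b. True}"

definition algebra_isomorphic ::
    "('k::field \<Rightarrow> 'a::ab_group_add \<Rightarrow> 'a) \<Rightarrow> ('a \<Rightarrow> 'a \<Rightarrow> 'a) \<Rightarrow>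
     ('k \<Rightarrow> 'b::ab_group_add \<Rightarrow> 'b) \<Rightarrow> ('b \<Rightarrow> 'b \<Rightarrow> 'b) \<Rightarrow> bool"
  where "algebra_isomorphic smul mul smul' mul' \<longleftrightarrow>
    (\<exists>f. Vector_Spaces.linear smul smul' f \<and> bij f \<and>
         (\<forall>x y. f (mul x y) = mul' (f x) (f y)))"

text \<open>
  The bilinear product with \<open>e\<^sub>i \<cdot> e\<^sub>j = T i j\<close>
  for the standard basis \<open>e\<^sub>i = axis i 1\<close>.
\<close>

definition table_mul ::
    "('n::finite \<Rightarrow> 'n \<Rightarrow> 'k::field ^ 'n) \<Rightarrow> 'k ^ 'n \<Rightarrow> 'k ^ 'n \<Rightarrow> 'k ^ 'n"
  where "table_mul T x y = (\<Sum>i\<in>UNIV. \<Sum>j\<in>UNIV. (x $ i * y $ j) *s T i j)"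

text \<open>
  The basis is indexed by the six-element numeral type \<open>6\<close>, in which
  \<open>1, \<dots>, 6\<close> are distinct (with \<open>6 = 0\<close>).
\<close>

definition A1_6 :: "'k::field ^ 6 \<Rightarrow> 'k ^ 6 \<Rightarrow> 'k ^ 6"
  where "A1_6 = table_mul (\<lambda>i j.
     if (i, j) = (1, 1) then axis 2 1
     else if (i, j) \<in> {(1, 3), (3, 1)} then axis 5 1
     else if (i, j) \<in> {(1, 4), (4, 1)} then axis 6 1
     else if (i, j) = (3, 3) then axis 4 1
     else if (i, j) \<in> {(3, 5), (5, 3)} then (- 1 / 2) *s axis 6 1
     else 0)"

definition A2_6 :: "'k::field \<Rightarrow> 'k \<Rightarrow> 'k ^ 6 \<Rightarrow> 'k ^ 6 \<Rightarrow> 'k ^ 6"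
  where "A2_6 \<beta> \<delta> = table_mul (\<lambda>i j.
     if (i, j) = (1, 1) then axis 2 1
     else if (i, j) \<in> {(1, 3), (3, 1)} then (- \<beta>) *s axis 2 1
     else if (i, j) \<in> {(1, 4), (4, 1)} then axis 5 1
     else if (i, j) \<in> {(1, 5), (5, 1)} then (- 1 / 2) *s axis 6 1
     else if (i, j) \<in> {(2, 4), (4, 2)} then axis 6 1
     else if (i, j) = (3, 3) then \<delta> *s axis 6 1
     else if (i, j) \<in> {(3, 5), (5, 3)} then \<beta> *s axis 6 1
     else 0)"

definition classification_list :: "('k::field ^ 6 \<Rightarrow> 'k ^ 6 \<Rightarrow> 'k ^ 6) list"
  where "classification_list = [A1_6, A2_6 0 0, A2_6 0 1, A2_6 1 0, A2_6 1 1]"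

end

theory Submission
  imports Defs
begin

text \<open>
  Let \<open>A\<close> be a Jacobi-Jordan algebra in characteristic different from \<open>2\<close> and \<open>3\<close>, and let \<open>A\<^sup>2\<close>, \<open>A\<^sup>3 = A A\<^sup>2\<close>,
  \<open>A\<^sup>4 = A A\<^sup>3\<close> be its powers. In terms of the multiplication operators the Jacobi identity says
  \<open>L\<^bsub>xy\<^esub> = - (L\<^sub>x L\<^sub>y + L\<^sub>y L\<^sub>x)\<close>; it implies \<open>x(xx) = 0\<close> and that the cube of each \<open>L\<^sub>x\<close> vanishes. An Engel type
  argument (lemma \<open>engel_relative\<close>) then shows that \<open>A I \<noteq> I\<close> for every nonzero subspace \<open>I\<close>.

  If \<open>A\<close> is not associative, then \<open>A\<^sup>3 \<noteq> 0\<close>, hence \<open>A\<^sup>4 \<noteq> A\<^sup>3\<close>, and some linear functional \<open>\<theta>\<close> vanishes on \<open>A\<^sup>4\<close>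
  but not on \<open>A\<^sup>3\<close>. The trilinear form \<open>\<theta>(u(vw))\<close> is a nonzero form on \<open>A/A\<^sup>2\<close> with vanishing cyclic sums. Such a
  form is never a product \<open>\<lambda>(u) s(v,w)\<close> (lemma \<open>P2_not_one_dimensional\<close>), so both \<open>A/A\<^sup>2\<close> and \<open>A\<^sup>2/A\<^sup>3\<close> have
  dimension at least \<open>2\<close>. In dimension \<open>6\<close> this leaves \<open>dim A\<^sup>2 = 4\<close> or \<open>dim A\<^sup>2 = 3\<close>.

  If \<open>dim A\<^sup>2 = 4\<close>, two elements \<open>x, y\<close> generate \<open>A\<close> and can be chosen with \<open>\<theta>(y(xy)) = 0\<close>. A relation between
  \<open>xx, xy, yy\<close> modulo \<open>A\<^sup>3\<close> would have to be \<open>yy \<in> A\<^sup>3\<close>, which makes \<open>A\<^sup>2\<close> too small (lemma \<open>square_notin_P3\<close>). So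
  \<open>A\<^sup>3\<close> is a line, \<open>A\<^sup>4 = 0\<close>, and the multiplication table is that of \<open>A\<^bsub>1,6\<^esub>\<close>.

  If \<open>dim A\<^sup>2 = 3\<close>, then \<open>A\<^sup>3\<close> is a line and \<open>A\<^sup>4 = 0\<close>, and counting dimensions gives \<open>w \<notin> A\<^sup>2\<close> with \<open>w A\<^sup>2 = 0\<close>. Two
  elements \<open>u, v\<close> span \<open>A\<close> together with \<open>w\<close> and \<open>A\<^sup>2\<close>. The value \<open>(wu)v\<close> of the alternating product \<open>(wa)b\<close> is zero
  or not, which gives \<open>\<beta> = 0\<close> (lemma \<open>isomorphic_A2_6_0\<close>) or \<open>\<beta> = 1\<close> (lemma \<open>isomorphic_A2_6_1\<close>). In both cases
  corrections of \<open>u, v, w\<close> bring the table to that of \<open>A\<^bsub>2,6\<^esub>\<close>, and \<open>ww\<close>, an element of the line \<open>A\<^sup>3\<close>, is zero or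
  can be scaled to the basis vector \<open>e\<^sub>6\<close>, which gives \<open>\<delta>\<close>.

  The five algebras are told apart by \<open>dim A\<^sup>2\<close> and by the behaviour of the elements \<open>w\<close> with \<open>w A\<^sup>2 = 0\<close>: \<open>\<delta> = 0\<close> if
  and only if all of them have square zero, and \<open>\<beta> = 0\<close> if and only if \<open>(wa)b = 0\<close> for all of them and all \<open>a, b\<close>
  (lemma \<open>classification_list_nonisomorphic\<close>).
\<close>

section \<open>Identities in Jacobi-Jordan algebras\<close>

locale jj_algebra_findim =
  jacobi_jordan_algebra smul mul + finite_dimensional_vector_space smul Basis
  for smul :: "'k::field \<Rightarrow> 'a::ab_group_add \<Rightarrow> 'a" (infixr "\<odot>" 75)
    and mul :: "'a \<Rightarrow> 'a \<Rightarrow> 'a" (infixl "\<cdot>" 77)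
    and Basis :: "'a set" +
  assumes two_neq_zero: "(2::'k) \<noteq> 0" and three_neq_zero: "(3::'k) \<noteq> 0"
begin

lemma mul_add_left: "(x + y) \<cdot> z = x \<cdot> z + y \<cdot> z"
  using linear_left by (simp add: Vector_Spaces.linear_iff)

lemma mul_add_right: "x \<cdot> (y + z) = x \<cdot> y + x \<cdot> z"
  using linear_right by (simp add: Vector_Spaces.linear_iff)

lemma mul_scale_left: "(c \<odot> x) \<cdot> y = c \<odot> (x \<cdot> y)"
  using linear_left by (simp add: Vector_Spaces.linear_iff)

lemma mul_scale_right: "x \<cdot> (c \<odot> y) = c \<odot> (x \<cdot> y)"
  using linear_right by (simp add: Vector_Spaces.linear_iff)

lemma mul_zero_left [simp]: "0 \<cdot> x = 0"
  using mul_scale_left[of 0 0 x] by simp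

lemma mul_zero_right [simp]: "x \<cdot> 0 = 0"
  using mul_scale_right[of x 0 0] by simp

lemma mul_minus_left: "(- x) \<cdot> y = - (x \<cdot> y)"
  using mul_scale_left[of "-1" x y] by simp

lemma mul_minus_right: "x \<cdot> (- y) = - (x \<cdot> y)"
  using mul_scale_right[of x "-1" y] by simp

lemma mul_diff_left: "(x - y) \<cdot> z = x \<cdot> z - y \<cdot> z"
  using mul_add_left[of x "- y" z] by (simp add: mul_minus_left)

lemma mul_diff_right: "x \<cdot> (y - z) = x \<cdot> y - x \<cdot> z"
  using mul_add_right[of x y "- z"] by (simp add: mul_minus_right)

lemmas mul_linear = mul_diff_left mul_diff_right mul_add_left mul_add_right mul_scale_left mul_scale_right
  mul_minus_left mul_minus_right

lemma double_eq_zero_iff: "x + x = 0 \<longleftrightarrow> (x::'a) = 0"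
proof -
  have "x + x = 2 \<odot> x"
    using scale_left_distrib[of 1 1 x] by simp
  then show ?thesis using two_neq_zero by simp
qed

lemma cube_zero: "x \<cdot> (x \<cdot> x) = 0"
proof -
  have "x \<cdot> (x \<cdot> x) + x \<cdot> (x \<cdot> x) + x \<cdot> (x \<cdot> x) = 3 \<odot> (x \<cdot> (x \<cdot> x))"
    using scale_left_distrib[of 2 1 "x \<cdot> (x \<cdot> x)"] scale_left_distrib[of 1 1 "x \<cdot> (x \<cdot> x)"]
    by simp
  with jacobi[of x x x] show ?thesis using three_neq_zero by simp
qed

text \<open>
  In operator form the Jacobi identity reads \<open>L\<^bsub>xy\<^esub> = - (L\<^sub>x L\<^sub>y + L\<^sub>y L\<^sub>x)\<close>, where
  \<open>L\<^sub>x\<close> is multiplication by \<open>x\<close>; all later computations rest on this form.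
\<close>

lemma mul_mul_left: "(x \<cdot> y) \<cdot> z = - (x \<cdot> (y \<cdot> z)) - y \<cdot> (x \<cdot> z)"
proof -
  have "x \<cdot> (y \<cdot> z) + y \<cdot> (x \<cdot> z) + (x \<cdot> y) \<cdot> z = 0"
    using jacobi[of x y z] by (simp only: mul_commute[of z x] mul_commute[of z "x \<cdot> y"])
  then show ?thesis
    by (metis add.commute diff_conv_add_uminus eq_neg_iff_add_eq_0 minus_add)
qed

lemma square_mul: "(x \<cdot> x) \<cdot> y = - (x \<cdot> (x \<cdot> y)) - x \<cdot> (x \<cdot> y)"
  by (rule mul_mul_left)

text \<open>
  Apply the operator identity to \<open>x\<close> and \<open>xx\<close>: since \<open>x(xx) = 0\<close> and \<open>L\<^bsub>xx\<^esub> = - 2 L\<^sub>x L\<^sub>x\<close>, it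
  becomes \<open>0 = 4 L\<^sub>x L\<^sub>x L\<^sub>x\<close>. So every multiplication operator is nilpotent.
\<close>

lemma mul_self_cubed: "x \<cdot> (x \<cdot> (x \<cdot> y)) = 0"
proof -
  let ?z = "x \<cdot> (x \<cdot> (x \<cdot> y))"
  have "0 = (x \<cdot> (x \<cdot> x)) \<cdot> y"
    by (simp add: cube_zero)
  also have "\<dots> = - (x \<cdot> ((x \<cdot> x) \<cdot> y)) - (x \<cdot> x) \<cdot> (x \<cdot> y)"
    by (rule mul_mul_left)
  also have "\<dots> = (?z + ?z) + (?z + ?z)"
    by (simp add: square_mul mul_diff_right mul_minus_right)
  finally show ?thesis using double_eq_zero_iff by metis
qed

lemma square_mul_scale: "(x \<cdot> x) \<cdot> y = (- 2) \<odot> (x \<cdot> (x \<cdot> y))"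
  using scale_left_distrib[of "-1" "-1" "x \<cdot> (x \<cdot> y)"] by (simp add: square_mul)

lemma mul_mul_self: "x \<cdot> (x \<cdot> y) = (- 1 / 2) \<odot> ((x \<cdot> x) \<cdot> y)"
  using two_neq_zero by (simp add: square_mul_scale)

lemma mul_span_mem:
  assumes "subspace N" and "\<And>a b. a \<in> X \<Longrightarrow> b \<in> Y \<Longrightarrow> a \<cdot> b \<in> N"
    and "x \<in> span X" and "y \<in> span Y"
  shows "x \<cdot> y \<in> N"
proof -
  have *: "a \<cdot> y \<in> N" if "a \<in> X" for a
    using \<open>y \<in> span Y\<close>
  proof (induction rule: span_induct_alt)
    case base
    then show ?case using assms(1) by (simp add: subspace_0)
  next
    case (step c u v)
    then show ?case using assms(1,2) that
      by (simp add: mul_linear subspace_add subspace_scale)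
  qed
  show ?thesis
    using \<open>x \<in> span X\<close>
  proof (induction rule: span_induct_alt)
    case base
    then show ?case using assms(1) by (simp add: subspace_0)
  next
    case (step c u v)
    then show ?case using assms(1) *
      by (simp add: mul_linear subspace_add subspace_scale)
  qed
qed

section \<open>Linear algebra\<close>

lemma span_add_cancel: "y + p \<in> span Y \<Longrightarrow> p \<in> span Y \<Longrightarrow> y \<in> span Y"
  using span_diff[of "y + p" Y p] by simp

lemma span_eq_UNIV_trans: "span X = UNIV \<Longrightarrow> X \<subseteq> span Y \<Longrightarrow> span Y = UNIV"
  using span_minimal[of X "span Y"] by auto

lemma exists_span_insert:
  assumes "subspace S" and "subspace T" and "S \<subseteq> T" and "dim T \<le> dim S + 1"
  shows "\<exists>p\<in>T. T = span (insert p S)"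
proof (cases "S = T")
  case True
  then have "T = span (insert 0 S)"
    using assms(2) by (simp add: span_eq_iff[THEN iffD2])
  then show ?thesis using assms(2) subspace_0 by blast
next
  case False
  with assms(3) obtain p where p: "p \<in> T" "p \<notin> S" by blast
  have "span (insert p S) = T"
  proof (rule subspace_dim_equal)
    show "span (insert p S) \<subseteq> T"
      using p(1) assms(2,3) by (intro span_minimal) auto
    show "dim T \<le> dim (span (insert p S))"
      using p(2) assms(1,4) by (simp add: dim_insert span_eq_iff[THEN iffD2])
  qed (use assms(2) in auto)
  with p(1) show ?thesis by blast
qed

lemma exists_span_insert_two:
  assumes "subspace S" and "dim (UNIV :: 'a set) = dim S + 2"
  shows "\<exists>u v. span (insert u (insert v S)) = UNIV"
proof -
  have "S \<noteq> UNIV" using assms(2) by auto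
  then obtain v where "v \<notin> S" by blast
  then have "dim (span (insert v S)) = dim S + 1"
    using assms(1) by (simp add: dim_insert span_eq_iff[THEN iffD2])
  then have "\<exists>u\<in>UNIV. UNIV = span (insert u (span (insert v S)))"
    using assms(2) by (intro exists_span_insert) simp_all
  moreover have "span (insert u (span T)) = span (insert u T)" for u T
    by (simp only: span_insert span_span)
  ultimately show ?thesis by metis
qed

lemma dim_inter_kernel:
  fixes \<phi> :: "'a \<Rightarrow> 'k"
  assumes lin: "Vector_Spaces.linear smul (*) \<phi>" and "subspace S"
  shows "dim S \<le> dim (S \<inter> {z. \<phi> z = 0}) + 1"
proof (cases "\<exists>s\<in>S. \<phi> s \<noteq> 0")
  case True
  then obtain s where s: "s \<in> S" "\<phi> s \<noteq> 0" by blast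
  interpret Vector_Spaces.linear smul "(*)" \<phi> by (rule lin)
  let ?K = "S \<inter> {z. \<phi> z = 0}"
  have "S \<subseteq> span (insert s ?K)"
  proof
    fix z assume "z \<in> S"
    let ?c = "\<phi> z / \<phi> s"
    have "z - ?c \<odot> s \<in> ?K"
      using s \<open>z \<in> S\<close> assms(2) by (simp add: diff scale subspace_diff subspace_scale)
    then have "z - ?c \<odot> s \<in> span ?K" by (rule span_base)
    then show "z \<in> span (insert s ?K)" using span_breakdown_eq by blast
  qed
  then have "dim S \<le> dim (insert s ?K)" by (rule dim_mono)
  then show ?thesis by (simp add: dim_insert split: if_splits)
next
  case False
  then have "S \<inter> {z. \<phi> z = 0} = S" by blast
  then show ?thesis by simp
qed

lemma exists_functional:
  assumes "subspace N" and "q \<notin> N"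
  obtains \<theta> where "Vector_Spaces.linear smul (*) \<theta>" and "\<And>n. n \<in> N \<Longrightarrow> \<theta> n = 0" and "\<theta> q = (1::'k)"
proof -
  interpret pair: vector_space_pair smul "(*) :: 'k \<Rightarrow> 'k \<Rightarrow> 'k"
    by unfold_locales
  obtain B where B: "B \<subseteq> N" "independent B" "N \<subseteq> span B"
    using maximal_independent_subset by blast
  have "span B = N"
    using B assms(1) span_minimal by blast
  with assms(2) have "q \<notin> span B" "q \<notin> B"
    using B by auto
  with B have "independent (insert q B)"
    by (intro independent_insertI)
  then obtain \<theta> where \<theta>: "Vector_Spaces.linear smul (*) \<theta>"
      and on_basis: "\<forall>x\<in>insert q B. \<theta> x = (if x = q then 1 else 0 :: 'k)"
    using pair.linear_independent_extend[of "insert q B" "\<lambda>x. if x = q then 1 else 0"]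
    by blast
  interpret th: Vector_Spaces.linear smul "(*)" \<theta> by (rule \<theta>)
  have "\<theta> n = 0" if "n \<in> span B" for n
    using that
  proof (induction rule: span_induct_alt)
    case (step c x y)
    then show ?case using on_basis \<open>q \<notin> B\<close> by (auto simp: th.add th.scale)
  qed (simp add: th.zero)
  with \<open>span B = N\<close> on_basis \<theta> show thesis
    by (intro that[of \<theta>]) auto
qed

section \<open>Nilpotency\<close>

text \<open>
  Jacobson's form of Engel's theorem: the operators \<open>L\<^sub>s\<close> are nilpotent and
  \<open>L\<^bsub>xy\<^esub> = - (L\<^sub>x L\<^sub>y + L\<^sub>y L\<^sub>x)\<close>, so the usual induction for Lie algebras goes through with this
  anticommutator in place of the commutator. A maximal proper subalgebra \<open>T\<close> of \<open>S\<close> is normalised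
  by some \<open>y\<close> outside \<open>T\<close>, which together with \<open>T\<close> spans \<open>S\<close>. The vectors of \<open>I\<close> that \<open>T\<close> sends into
  \<open>N\<close> form a subspace stable under \<open>L\<^sub>y\<close>, and nilpotency of \<open>L\<^sub>y\<close> yields a vector that \<open>y\<close> sends into
  \<open>N\<close> as well. The subspace \<open>N\<close> takes the place of a quotient of the module.
\<close>

lemma engel_relative:
  assumes "subspace S" and "\<And>x y. x \<in> S \<Longrightarrow> y \<in> S \<Longrightarrow> x \<cdot> y \<in> S"
    and "subspace I" and "subspace N" and "N \<subset> I"
    and "\<And>s v. s \<in> S \<Longrightarrow> v \<in> I \<Longrightarrow> s \<cdot> v \<in> I"
    and "\<And>s v. s \<in> S \<Longrightarrow> v \<in> N \<Longrightarrow> s \<cdot> v \<in> N"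
  shows "\<exists>v \<in> I - N. \<forall>s\<in>S. s \<cdot> v \<in> N"
  using assms
proof (induction "dim S" arbitrary: S I N rule: less_induct)
  case less
  note S = less.prems(1,2) and IN = less.prems(3-7)
  show ?case
  proof (cases "S = {0}")
    case True
    then show ?thesis using IN by (auto simp: subspace_0)
  next
    case False
    define alg where "alg T \<longleftrightarrow> subspace T \<and> (\<forall>x\<in>T. \<forall>y\<in>T. x \<cdot> y \<in> T) \<and> T \<subset> S" for T
    have "alg {0}"
      using S(1) False by (auto simp: alg_def subspace_0)
    moreover have "\<forall>T. alg T \<longrightarrow> dim T < Suc (dim S)"
      by (auto simp: alg_def less_Suc_eq_le intro: dim_subset)
    ultimately obtain T where T: "alg T" and T_max: "\<And>T'. alg T' \<Longrightarrow> dim T' \<le> dim T"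
      using ex_has_greatest_nat[of alg "{0}" dim "Suc (dim S)"] by auto
    then have T_sub: "subspace T" and T_alg: "\<And>x y. x \<in> T \<Longrightarrow> y \<in> T \<Longrightarrow> x \<cdot> y \<in> T" and T_S: "T \<subset> S"
      by (auto simp: alg_def)
    have "dim T < dim S"
      using dim_psubset[of T S] T_sub S(1) T_S by (simp add: span_eq_iff[THEN iffD2])
    note dim_less = this
    have IH: "\<exists>v \<in> I - N. \<forall>t\<in>T. t \<cdot> v \<in> N"
      if "subspace I" "subspace N" "N \<subset> I" "\<And>t v. t \<in> T \<Longrightarrow> v \<in> I \<Longrightarrow> t \<cdot> v \<in> I"
        "\<And>t v. t \<in> T \<Longrightarrow> v \<in> N \<Longrightarrow> t \<cdot> v \<in> N" for I N
      by (rule less.hyps[OF dim_less]) (use T_sub T_alg that in auto)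
    have "\<exists>y \<in> S - T. \<forall>t\<in>T. t \<cdot> y \<in> T"
      using IH[OF S(1) T_sub T_S] S(2) T_S T_alg by blast
    then obtain y0 where y0: "y0 \<in> S - T" "\<And>t. t \<in> T \<Longrightarrow> t \<cdot> y0 \<in> T" by blast
    \<comment> \<open>For \<open>T + \<langle>y\<rangle>\<close> to be a subalgebra, \<open>yy\<close> has to lie in \<open>T\<close>. If \<open>y0 y0\<close> does not, it is itself
      a suitable \<open>y\<close>, because its square vanishes.\<close>
    obtain y where y: "y \<in> S - T" "\<And>t. t \<in> T \<Longrightarrow> t \<cdot> y \<in> T" "y \<cdot> y \<in> T"
    proof (cases "y0 \<cdot> y0 \<in> T")
      case True
      then show thesis using y0 that by blast
    next
      case False
      have "t \<cdot> (y0 \<cdot> y0) \<in> T" if "t \<in> T" for t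
      proof -
        have "y0 \<cdot> (y0 \<cdot> t) \<in> T"
          using y0(2) that by (metis mul_commute)
        then show ?thesis
          using square_mul[of y0 t] T_sub
          by (metis mul_commute subspace_diff subspace_neg)
      qed
      moreover have "(y0 \<cdot> y0) \<cdot> (y0 \<cdot> y0) = 0"
        by (simp add: square_mul cube_zero)
      moreover have "y0 \<cdot> y0 \<in> S - T"
        using False y0(1) S(2) by blast
      ultimately show thesis
        using that[of "y0 \<cdot> y0"] T_sub by (simp add: subspace_0)
    qed
    let ?T' = "span (insert y T)"
    have y_mul_T: "y \<cdot> t \<in> T" if "t \<in> T" for t
      using y(2)[OF that] by (simp only: mul_commute[of y t])
    have gen: "a \<cdot> b \<in> T" if "a \<in> insert y T" "b \<in> insert y T" for a b
      using that y(2,3) T_alg y_mul_T by blast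
    have "a \<cdot> b \<in> T" if "a \<in> ?T'" "b \<in> ?T'" for a b
      using mul_span_mem[OF T_sub gen that] .
    moreover have "T \<subseteq> ?T'"
      by (meson span_superset subset_insertI subset_trans)
    moreover have "?T' \<subseteq> S"
      using y(1) T_S S(1) by (intro span_minimal) auto
    moreover have "dim ?T' > dim T"
      using y(1) T_sub by (simp add: dim_insert span_eq_iff[THEN iffD2])
    ultimately have S_eq: "S = ?T'"
      using T_max[of ?T'] by (auto simp: alg_def)
    define I' where "I' = {v \<in> I. \<forall>t\<in>T. t \<cdot> v \<in> N}"
    obtain v where v: "v \<in> I - N" "\<forall>t\<in>T. t \<cdot> v \<in> N"
      using IH[OF IN(1-3)] IN(4,5) T_S by blast
    have y_I': "y \<cdot> v \<in> I'" if "v \<in> I'" for v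
    proof -
      have "t \<cdot> (y \<cdot> v) \<in> N" if "t \<in> T" for t
      proof -
        have "(t \<cdot> y) \<cdot> v \<in> N" "y \<cdot> (t \<cdot> v) \<in> N"
          using \<open>v \<in> I'\<close> y(1,2) that IN(5) by (auto simp: I'_def)
        moreover have "t \<cdot> (y \<cdot> v) = - ((t \<cdot> y) \<cdot> v) - y \<cdot> (t \<cdot> v)"
          by (simp add: mul_mul_left)
        ultimately show ?thesis
          using IN(2) by (simp add: subspace_diff subspace_neg)
      qed
      then show ?thesis using that y(1) IN(4) by (auto simp: I'_def)
    qed
    have "\<exists>v' \<in> I' - N. y \<cdot> v' \<in> N"
    proof (rule ccontr)
      assume "\<not> ?thesis"
      then have "y \<cdot> v' \<in> I' - N" if "v' \<in> I' - N" for v'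
        using that y_I' by blast
      moreover have "v \<in> I' - N" using v by (auto simp: I'_def)
      ultimately have "y \<cdot> (y \<cdot> (y \<cdot> v)) \<in> I' - N" by blast
      then show False
        using IN(2) by (simp add: mul_self_cubed subspace_0)
    qed
    then obtain v' where v': "v' \<in> I' - N" "y \<cdot> v' \<in> N" by blast
    have "s \<cdot> v' \<in> N" if "s \<in> S" for s
    proof (rule mul_span_mem[OF IN(2)])
      show "s \<in> span (insert y T)" using that S_eq by simp
      show "v' \<in> span {v'}" by (simp add: span_base)
    qed (use v' in \<open>auto simp: I'_def\<close>)
    then show ?thesis using v' by (auto simp: I'_def)
  qed
qed

definition products :: "'a set \<Rightarrow> 'a set"
  where "products I = span {a \<cdot> x |a x. x \<in> I}"

lemma subspace_products [simp]: "subspace (products I)"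
  by (simp add: products_def)

lemma mul_in_products [simp]: "x \<in> I \<Longrightarrow> a \<cdot> x \<in> products I"
  unfolding products_def by (rule span_base) blast

lemma mul_in_products' [simp]: "x \<in> I \<Longrightarrow> x \<cdot> a \<in> products I"
  by (metis mul_commute mul_in_products)

lemma products_subsetI:
  assumes "subspace N" and "\<And>a x. x \<in> I \<Longrightarrow> a \<cdot> x \<in> N"
  shows "products I \<subseteq> N"
  unfolding products_def using assms by (intro span_minimal) auto

lemma products_mono: "I \<subseteq> J \<Longrightarrow> products I \<subseteq> products J"
  by (rule products_subsetI) auto

text \<open>
  A maximal proper stable subspace \<open>N\<close> of \<open>I\<close> has codimension one: Engel's theorem provides
  \<open>v \<in> I - N\<close> with \<open>A v \<subseteq> N\<close>, so \<open>N + \<langle>v\<rangle>\<close> is stable and hence equals \<open>I\<close>. But then \<open>A I \<subseteq> N\<close>.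
\<close>

lemma products_eq_self_imp_zero:
  assumes "subspace I" and "products I = I"
  shows "I = {0}"
proof (rule ccontr)
  assume "I \<noteq> {0}"
  define inv where "inv N \<longleftrightarrow> subspace N \<and> N \<subset> I \<and> products N \<subseteq> N" for N
  have "inv {0}"
    using assms(1) \<open>I \<noteq> {0}\<close> by (auto simp: inv_def subspace_0 products_def span_minimal)
  moreover have "\<forall>N. inv N \<longrightarrow> dim N < Suc (dim I)"
    by (auto simp: inv_def less_Suc_eq_le intro: dim_subset)
  ultimately obtain N where N: "inv N" and N_max: "\<And>N'. inv N' \<Longrightarrow> dim N' \<le> dim N"
    using ex_has_greatest_nat[of inv "{0}" dim "Suc (dim I)"] by auto
  have N_sub: "subspace N" and N_I: "N \<subset> I" and "products N \<subseteq> N"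
    using N by (auto simp: inv_def)
  then have N_mul: "a \<cdot> x \<in> N" if "x \<in> N" for a x
    using mul_in_products[OF that, of a] by blast
  have I_mul: "a \<cdot> x \<in> I" if "x \<in> I" for a x
    using assms(2) mul_in_products[OF that, of a] by simp
  obtain v where v: "v \<in> I - N" "\<And>s. s \<cdot> v \<in> N"
    using engel_relative[of UNIV I N] assms(1) N_sub N_I N_mul I_mul by auto
  let ?N' = "span (insert v N)"
  have in_N: "a \<cdot> x \<in> N" if "x \<in> ?N'" for a x
  proof (rule mul_span_mem[OF N_sub _ _ that])
    show "a \<in> span UNIV" by simp
  qed (use v N_mul in auto)
  have "N \<subseteq> ?N'"
    by (meson span_superset subset_insertI subset_trans)
  with in_N have "products ?N' \<subseteq> ?N'"
    by (intro products_subsetI) auto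
  moreover have "?N' \<subseteq> I"
    using v N_I assms(1) by (intro span_minimal) auto
  moreover have "dim ?N' > dim N"
    using v(1) N_sub by (simp add: dim_insert span_eq_iff[THEN iffD2])
  ultimately have "I = ?N'"
    using N_max[of ?N'] by (auto simp: inv_def)
  then have "products I \<subseteq> N"
    using in_N N_sub by (intro products_subsetI) auto
  then show False using assms(2) N_I by blast
qed

text \<open>
  The powers \<open>A\<^sup>2\<close>, \<open>A\<^sup>3 = A A\<^sup>2\<close> and \<open>A\<^sup>4 = A A\<^sup>3\<close> of the algebra.
\<close>

abbreviation P2 :: "'a set" where "P2 \<equiv> products UNIV"
abbreviation P3 :: "'a set" where "P3 \<equiv> products P2"
abbreviation P4 :: "'a set" where "P4 \<equiv> products P3"

lemma P3_subset_P2: "P3 \<subseteq> P2"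
  by (rule products_mono) simp

lemma P4_subset_P3: "P4 \<subseteq> P3"
  by (rule products_mono[OF P3_subset_P2])

text \<open>
  Multiplying by \<open>ab\<close> amounts to multiplying twice, since \<open>(ab)x = - a(bx) - b(ax)\<close>.
\<close>

lemma P2_mul_in_products:
  assumes "p \<in> P2" and "\<And>a x. x \<in> I \<Longrightarrow> a \<cdot> x \<in> I" and "x \<in> I"
  shows "p \<cdot> x \<in> products (products I)"
proof (rule mul_span_mem[OF subspace_products _ assms(1)[unfolded products_def]])
  show "x \<in> span {x}" by (simp add: span_base)
  fix p y assume "p \<in> {a \<cdot> b |a b. b \<in> UNIV}" and "y \<in> {x}"
  then obtain a b where "p = a \<cdot> b" and "y = x" by blast
  moreover have "a \<cdot> (b \<cdot> x) \<in> products (products I)" "b \<cdot> (a \<cdot> x) \<in> products (products I)"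
    using assms(3) by auto
  ultimately show "p \<cdot> y \<in> products (products I)"
    by (simp add: mul_mul_left subspace_diff subspace_neg)
qed

lemma P2_mul_P2: "p \<in> P2 \<Longrightarrow> p' \<in> P2 \<Longrightarrow> p \<cdot> p' \<in> P4"
  by (rule P2_mul_in_products) auto

lemma P2_mul_P3: "p \<in> P2 \<Longrightarrow> q \<in> P3 \<Longrightarrow> p \<cdot> q \<in> products P4"
  by (rule P2_mul_in_products) (use P3_subset_P2 in \<open>auto intro!: mul_in_products\<close>)

lemma P3_zero_imp_associative: "P3 = {0} \<Longrightarrow> associative (\<cdot>)"
  unfolding associative_def by (metis UNIV_I mul_in_products mul_in_products' singletonD)

end

section \<open>The five algebras\<close>

lemma exhaust_6:
  fixes i :: 6
  shows "i = 1 \<or> i = 2 \<or> i = 3 \<or> i = 4 \<or> i = 5 \<or> i = 6"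
proof (induct i)
  case (of_int z)
  then have "z = 0 \<or> z = 1 \<or> z = 2 \<or> z = 3 \<or> z = 4 \<or> z = 5" by fastforce
  then show ?case by auto
qed

lemma forall_6: "(\<forall>i::6. P i) \<longleftrightarrow> P 1 \<and> P 2 \<and> P 3 \<and> P 4 \<and> P 5 \<and> P 6"
  by (metis exhaust_6)

lemma UNIV_6: "UNIV = {1, 2, 3, 4, 5, 6 :: 6}"
  using exhaust_6 by auto

lemma sum_6: "sum f (UNIV :: 6 set) = f 1 + f 2 + f 3 + f 4 + f 5 + f 6"
  unfolding UNIV_6 by (simp add: ac_simps)

lemma table_mul_component:
  "table_mul T x y $ k = (\<Sum>i\<in>UNIV. \<Sum>j\<in>UNIV. x $ i * y $ j * T i j $ k)"
  by (simp add: table_mul_def sum_component)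

text \<open>
  Coordinates of the tabulated products; with them every statement about the five algebras becomes a
  polynomial identity in coordinates.
\<close>

lemma A1_6_component:
  "A1_6 x y $ 1 = 0" "A1_6 x y $ 2 = x $ 1 * y $ 1" "A1_6 x y $ 3 = 0"
  "A1_6 x y $ 4 = x $ 3 * y $ 3" "A1_6 x y $ 5 = x $ 1 * y $ 3 + x $ 3 * y $ 1"
  "A1_6 x y $ 6 = x $ 1 * y $ 4 + x $ 4 * y $ 1 + - 1 / 2 * (x $ 3 * y $ 5 + x $ 5 * y $ 3)"
  unfolding A1_6_def table_mul_component sum_6
  by (simp_all add: axis_def distrib_left)

lemma A2_6_component:
  "A2_6 \<beta> \<delta> x y $ 1 = 0"
  "A2_6 \<beta> \<delta> x y $ 2 = x $ 1 * y $ 1 - \<beta> * (x $ 1 * y $ 3 + x $ 3 * y $ 1)"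
  "A2_6 \<beta> \<delta> x y $ 3 = 0" "A2_6 \<beta> \<delta> x y $ 4 = 0"
  "A2_6 \<beta> \<delta> x y $ 5 = x $ 1 * y $ 4 + x $ 4 * y $ 1"
  "A2_6 \<beta> \<delta> x y $ 6 = - 1 / 2 * (x $ 1 * y $ 5 + x $ 5 * y $ 1) + (x $ 2 * y $ 4 + x $ 4 * y $ 2)
     + \<delta> * (x $ 3 * y $ 3) + \<beta> * (x $ 3 * y $ 5 + x $ 5 * y $ 3)"
  unfolding A2_6_def table_mul_component sum_6
  by (simp_all add: axis_def algebra_simps)


lemma four_neq_zero: "(2 :: 'k::field) \<noteq> 0 \<Longrightarrow> (4 :: 'k) \<noteq> 0"
  using mult_eq_0_iff[of "2 :: 'k" 2] by simp

lemma A1_6_jacobi_jordan: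
  assumes "(2 :: 'k::field) \<noteq> 0"
  shows "jacobi_jordan_algebra (*s) (A1_6 :: 'k ^ 6 \<Rightarrow> _)"
proof unfold_locales
  fix x y z :: "'k ^ 6"
  have four: "(4 :: 'k) \<noteq> 0" using assms four_neq_zero by blast
  show "A1_6 x y = A1_6 y x"
    by (simp add: vec_eq_iff forall_6 A1_6_component algebra_simps)
  show "A1_6 x (A1_6 y z) + A1_6 y (A1_6 z x) + A1_6 z (A1_6 x y) = 0"
    using assms four by (simp add: vec_eq_iff forall_6 A1_6_component field_simps)
qed (simp_all add: vec_eq_iff forall_6 A1_6_component algebra_simps)

lemma A2_6_jacobi_jordan:
  assumes "(2 :: 'k::field) \<noteq> 0"
  shows "jacobi_jordan_algebra (*s) (A2_6 \<beta> \<delta> :: 'k ^ 6 \<Rightarrow> _)"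
proof unfold_locales
  fix x y z :: "'k ^ 6"
  have four: "(4 :: 'k) \<noteq> 0" using assms four_neq_zero by blast
  show "A2_6 \<beta> \<delta> x y = A2_6 \<beta> \<delta> y x"
    by (simp add: vec_eq_iff forall_6 A2_6_component algebra_simps)
  show "A2_6 \<beta> \<delta> x (A2_6 \<beta> \<delta> y z) + A2_6 \<beta> \<delta> y (A2_6 \<beta> \<delta> z x)
      + A2_6 \<beta> \<delta> z (A2_6 \<beta> \<delta> x y) = 0"
    using assms four by (simp add: vec_eq_iff forall_6 A2_6_component field_simps)
qed (simp_all add: vec_eq_iff forall_6 A2_6_component algebra_simps)

text \<open>
  In the five algebras associativity fails because some \<open>(ab)c = e\<^sub>6\<close> while \<open>a(bc) = - 1/2 e\<^sub>6\<close>; these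
  differ exactly because \<open>3 \<noteq> 0\<close>.
\<close>

lemma one_neq_minus_half:
  assumes "(2 :: 'k::field) \<noteq> 0" and "(3 :: 'k) \<noteq> 0"
  shows "(1 :: 'k) \<noteq> - (1 / 2)"
proof
  assume "(1 :: 'k) = - (1 / 2)"
  then have "(2 :: 'k) = - 1"
    using assms(1) by (simp add: field_simps)
  then have "(3 :: 'k) = 0"
    using eq_neg_iff_add_eq_0[of 2 "1 :: 'k"] by simp
  with assms(2) show False ..
qed

lemma A1_6_not_associative:
  assumes "(2 :: 'k::field) \<noteq> 0" and "(3 :: 'k) \<noteq> 0"
  shows "\<not> associative (A1_6 :: 'k ^ 6 \<Rightarrow> _)"
proof
  let ?e1 = "axis 1 1 :: 'k ^ 6" and ?e3 = "axis 3 1 :: 'k ^ 6"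
  assume "associative (A1_6 :: 'k ^ 6 \<Rightarrow> _)"
  then have "A1_6 (A1_6 ?e3 ?e3) ?e1 $ 6 = A1_6 ?e3 (A1_6 ?e3 ?e1) $ 6"
    by (simp add: associative_def)
  then show False
    using one_neq_minus_half[OF assms] by (simp add: A1_6_component axis_def)
qed

lemma A2_6_not_associative:
  assumes "(2 :: 'k::field) \<noteq> 0" and "(3 :: 'k) \<noteq> 0"
  shows "\<not> associative (A2_6 \<beta> \<delta> :: 'k ^ 6 \<Rightarrow> _)"
proof
  let ?e1 = "axis 1 1 :: 'k ^ 6" and ?e4 = "axis 4 1 :: 'k ^ 6"
  assume "associative (A2_6 \<beta> \<delta> :: 'k ^ 6 \<Rightarrow> _)"
  then have "A2_6 \<beta> \<delta> (A2_6 \<beta> \<delta> ?e1 ?e1) ?e4 $ 6 = A2_6 \<beta> \<delta> ?e1 (A2_6 \<beta> \<delta> ?e1 ?e4) $ 6"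
    by (simp add: associative_def)
  then show False
    using one_neq_minus_half[OF assms] by (simp add: A2_6_component axis_def)
qed

lemma dim_span_axes: "vec.dim (vec.span ((\<lambda>i. axis i (1 :: 'k::field)) ` I)) = card I"
proof -
  have "vec.independent ((\<lambda>i. axis i (1 :: 'k)) ` I)"
    by (rule vec.independent_mono[OF independent_cart_basis]) (auto simp: cart_basis_def)
  moreover have "inj_on (\<lambda>i. axis i (1 :: 'k)) I"
    by (auto simp: inj_on_def axis_eq_axis)
  ultimately show ?thesis
    by (simp add: vec.dim_eq_card_independent card_image)
qed

lemma in_span_axes:
  assumes "\<And>i. i \<notin> I \<Longrightarrow> x $ i = 0"
  shows "x \<in> vec.span ((\<lambda>i. axis i (1 :: 'k::field)) ` I)"
proof -
  have "(\<Sum>i\<in>I. x $ i *s axis i 1) $ j = x $ j" for j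
    using assms[of j] by (simp add: sum_component axis_def if_distrib[of "\<lambda>y. _ * y"] sum.delta cong: if_cong)
  then have "x = (\<Sum>i\<in>I. x $ i *s axis i 1)"
    by (simp add: vec_eq_iff)
  then show ?thesis
    by (metis (no_types, lifting) image_eqI vec.span_base vec.span_scale vec.span_sum)
qed

lemma dim_square_eq_card:
  fixes mul :: "'k::field ^ 'n \<Rightarrow> 'k ^ 'n \<Rightarrow> 'k ^ 'n"
  assumes "\<And>i. i \<in> I \<Longrightarrow> \<exists>a b. mul a b = axis i 1"
    and "\<And>i a b. i \<notin> I \<Longrightarrow> mul a b $ i = 0"
  shows "vec.dim (algebra_square (*s) mul) = card I"
proof -
  have "algebra_square (*s) mul = vec.span ((\<lambda>i. axis i 1) ` I)"
    unfolding algebra_square_def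
  proof (rule antisym; intro vec.span_minimal vec.subspace_span)
    show "{mul a b |a b. True} \<subseteq> vec.span ((\<lambda>i. axis i 1) ` I)"
      using in_span_axes[of I] assms(2) by blast
    show "(\<lambda>i. axis i 1) ` I \<subseteq> vec.span {mul a b |a b. True}"
    proof (rule image_subsetI)
      fix i assume "i \<in> I"
      then obtain a b where "mul a b = axis i 1" using assms(1) by blast
      then show "axis i 1 \<in> vec.span {mul a b |a b. True}"
        by (metis (mono_tags, lifting) mem_Collect_eq vec.span_base)
    qed
  qed
  then show ?thesis by (simp only: dim_span_axes)
qed

lemma dim_A1_6_square: "vec.dim (algebra_square (*s) (A1_6 :: 'k::field ^ 6 \<Rightarrow> _)) = 4"
proof -
  let ?e = "\<lambda>i. axis i 1 :: 'k ^ 6"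
  have "A1_6 (?e 1) (?e 1) = ?e 2" "A1_6 (?e 3) (?e 3) = ?e 4"
    "A1_6 (?e 1) (?e 3) = ?e 5" "A1_6 (?e 1) (?e 4) = ?e 6"
    by (simp_all add: vec_eq_iff forall_6 A1_6_component) (simp_all add: axis_def)
  then have "\<exists>a b. A1_6 a b = ?e i" if "i \<in> {2, 4, 5, 6}" for i
    using that by blast
  moreover have "A1_6 a b $ i = 0" if "i \<notin> {2, 4, 5, 6}" for i and a b :: "'k ^ 6"
    using that exhaust_6[of i] by (auto simp: A1_6_component)
  ultimately have "vec.dim (algebra_square (*s) (A1_6 :: 'k ^ 6 \<Rightarrow> _)) = card {2, 4, 5, 6 :: 6}"
    by (rule dim_square_eq_card)
  then show ?thesis by simp
qed

lemma dim_A2_6_square: "vec.dim (algebra_square (*s) (A2_6 \<beta> \<delta> :: 'k::field ^ 6 \<Rightarrow> _)) = 3"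
proof -
  let ?e = "\<lambda>i. axis i 1 :: 'k ^ 6"
  have "A2_6 \<beta> \<delta> (?e 1) (?e 1) = ?e 2" "A2_6 \<beta> \<delta> (?e 1) (?e 4) = ?e 5" "A2_6 \<beta> \<delta> (?e 2) (?e 4) = ?e 6"
    by (simp_all add: vec_eq_iff forall_6 A2_6_component) (simp_all add: axis_def)
  then have "\<exists>a b. A2_6 \<beta> \<delta> a b = ?e i" if "i \<in> {2, 5, 6}" for i
    using that by blast
  moreover have "A2_6 \<beta> \<delta> a b $ i = 0" if "i \<notin> {2, 5, 6}" for i and a b :: "'k ^ 6"
    using that exhaust_6[of i] by (auto simp: A2_6_component)
  ultimately have "vec.dim (algebra_square (*s) (A2_6 \<beta> \<delta> :: 'k ^ 6 \<Rightarrow> _)) = card {2, 5, 6 :: 6}"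
    by (rule dim_square_eq_card)
  then show ?thesis by simp
qed

section \<open>Invariants separating the five algebras\<close>

text \<open>
  The elements \<open>w\<close> with \<open>w A\<^sup>2 = 0\<close> form a subspace attached canonically to the algebra. In
  \<open>A\<^bsub>2,6\<^esub>(\<beta>,\<delta>)\<close> it is spanned by \<open>A\<^sup>2\<close> and \<open>2\<beta> e\<^sub>1 + e\<^sub>3\<close>; the square of that vector detects \<open>\<delta>\<close>,
  and its products with two further elements detect \<open>\<beta>\<close>.
\<close>

definition annihilates_square :: "('a \<Rightarrow> 'a \<Rightarrow> 'a::zero) \<Rightarrow> 'a \<Rightarrow> bool"
  where "annihilates_square mul w \<longleftrightarrow> (\<forall>a b. mul w (mul a b) = 0)"

definition annihilators_square_zero :: "('a \<Rightarrow> 'a \<Rightarrow> 'a::zero) \<Rightarrow> bool"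
  where "annihilators_square_zero mul \<longleftrightarrow> (\<forall>w. annihilates_square mul w \<longrightarrow> mul w w = 0)"

definition annihilators_multiply_to_zero :: "('a \<Rightarrow> 'a \<Rightarrow> 'a::zero) \<Rightarrow> bool"
  where "annihilators_multiply_to_zero mul \<longleftrightarrow>
    (\<forall>w. annihilates_square mul w \<longrightarrow> (\<forall>a b. mul (mul w a) b = 0))"

lemma A2_6_annihilates_square_iff:
  assumes "(2 :: 'k::field) \<noteq> 0"
  shows "annihilates_square (A2_6 \<beta> \<delta>) w \<longleftrightarrow> w $ 4 = 0 \<and> w $ 1 = 2 * \<beta> * (w $ 3 :: 'k)"
proof
  let ?e = "\<lambda>i. axis i 1 :: 'k ^ 6"
  assume "annihilates_square (A2_6 \<beta> \<delta>) w"
  then have "A2_6 \<beta> \<delta> w (A2_6 \<beta> \<delta> (?e 1) (?e 1)) $ 6 = 0" "A2_6 \<beta> \<delta> w (A2_6 \<beta> \<delta> (?e 1) (?e 4)) $ 6 = 0"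
    by (simp_all add: annihilates_square_def)
  then show "w $ 4 = 0 \<and> w $ 1 = 2 * \<beta> * w $ 3"
    using assms by (simp add: A2_6_component) (simp add: axis_def field_simps)
next
  assume "w $ 4 = 0 \<and> w $ 1 = 2 * \<beta> * (w $ 3)"
  then show "annihilates_square (A2_6 \<beta> \<delta>) w"
    using assms
    by (simp add: annihilates_square_def vec_eq_iff forall_6 A2_6_component)
qed

lemma A2_6_annihilators_square_zero_iff:
  assumes "(2 :: 'k::field) \<noteq> 0"
  shows "annihilators_square_zero (A2_6 \<beta> \<delta> :: 'k ^ 6 \<Rightarrow> _) \<longleftrightarrow> \<delta> = 0"
proof
  assume *: "annihilators_square_zero (A2_6 \<beta> \<delta> :: 'k ^ 6 \<Rightarrow> _)"
  \<comment> \<open>The vector \<open>2\<beta> e\<^sub>1 + e\<^sub>3\<close> has square \<open>\<delta> e\<^sub>6\<close>.\<close>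
  define w :: "'k ^ 6" where "w = (\<chi> i. if i = 1 then 2 * \<beta> else if i = 3 then 1 else 0)"
  have "annihilates_square (A2_6 \<beta> \<delta>) w"
    using assms by (simp add: A2_6_annihilates_square_iff w_def)
  with * have "A2_6 \<beta> \<delta> w w $ 6 = 0"
    by (simp add: annihilators_square_zero_def)
  then show "\<delta> = 0" by (simp add: A2_6_component w_def)
next
  assume "\<delta> = 0"
  then show "annihilators_square_zero (A2_6 \<beta> \<delta> :: 'k ^ 6 \<Rightarrow> _)"
    using assms
    by (auto simp: annihilators_square_zero_def A2_6_annihilates_square_iff vec_eq_iff forall_6
        A2_6_component algebra_simps)
qed

lemma A2_6_annihilators_multiply_to_zero_iff:
  assumes "(2 :: 'k::field) \<noteq> 0"
  shows "annihilators_multiply_to_zero (A2_6 \<beta> \<delta> :: 'k ^ 6 \<Rightarrow> _) \<longleftrightarrow> \<beta> = 0"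
proof
  assume *: "annihilators_multiply_to_zero (A2_6 \<beta> \<delta> :: 'k ^ 6 \<Rightarrow> _)"
  \<comment> \<open>The vector \<open>2\<beta> e\<^sub>1 + e\<^sub>3\<close> has product \<open>\<beta> e\<^sub>2\<close> with \<open>e\<^sub>1\<close>, and \<open>e\<^sub>2 e\<^sub>4 = e\<^sub>6\<close>.\<close>
  define w :: "'k ^ 6" where "w = (\<chi> i. if i = 1 then 2 * \<beta> else if i = 3 then 1 else 0)"
  have "annihilates_square (A2_6 \<beta> \<delta>) w"
    using assms by (simp add: A2_6_annihilates_square_iff w_def)
  with * have "A2_6 \<beta> \<delta> (A2_6 \<beta> \<delta> w (axis 1 1)) (axis 4 1) $ 6 = 0"
    by (simp add: annihilators_multiply_to_zero_def)
  then show "\<beta> = 0" by (simp add: A2_6_component) (simp add: w_def axis_def)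
next
  assume "\<beta> = 0"
  then show "annihilators_multiply_to_zero (A2_6 \<beta> \<delta> :: 'k ^ 6 \<Rightarrow> _)"
    using assms
    by (auto simp: annihilators_multiply_to_zero_def A2_6_annihilates_square_iff vec_eq_iff forall_6
        A2_6_component)
qed

lemma algebra_isomorphic_sym:
  assumes "algebra_isomorphic s1 m1 s2 m2"
  shows "algebra_isomorphic s2 m2 s1 m1"
proof -
  obtain f where f: "Vector_Spaces.linear s1 s2 f" "bij f" "\<And>x y. f (m1 x y) = m2 (f x) (f y)"
    using assms by (auto simp: algebra_isomorphic_def)
  let ?g = "inv f"
  have fg: "f (?g y) = y" for y using f(2) by (simp add: bij_is_surj surj_f_inv_f)
  have gf: "?g (f x) = x" for x using f(2) by (simp add: bij_is_inj)
  interpret Vector_Spaces.linear s1 s2 f by (rule f(1))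
  have "?g (x + y) = ?g x + ?g y" for x y
    using gf[of "?g x + ?g y"] by (simp only: add fg)
  moreover have "?g (s2 c x) = s1 c (?g x)" for x c
    using gf[of "s1 c (?g x)"] by (simp only: scale fg)
  ultimately have "Vector_Spaces.linear s2 s1 ?g"
    using f(1) by (simp add: Vector_Spaces.linear_iff)
  moreover have "?g (m2 x y) = m1 (?g x) (?g y)" for x y
    using f(3) fg gf by metis
  ultimately show ?thesis
    using bij_imp_bij_inv[OF f(2)] by (auto simp: algebra_isomorphic_def)
qed

lemma algebra_isomorphic_trans:
  assumes "algebra_isomorphic s1 m1 s2 m2" and "algebra_isomorphic s2 m2 s3 m3"
  shows "algebra_isomorphic s1 m1 s3 m3"
proof -
  obtain f g where f: "Vector_Spaces.linear s1 s2 f" "bij f" "\<And>x y. f (m1 x y) = m2 (f x) (f y)"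
    and g: "Vector_Spaces.linear s2 s3 g" "bij g" "\<And>x y. g (m2 x y) = m3 (g x) (g y)"
    using assms unfolding algebra_isomorphic_def by metis
  have "Vector_Spaces.linear s1 s3 (g \<circ> f)"
    using f(1) g(1) by (simp add: Vector_Spaces.linear_iff)
  then show ?thesis
    using bij_comp[OF f(2) g(2)] f(3) g(3) unfolding algebra_isomorphic_def
    by (intro exI[of _ "g \<circ> f"]) simp
qed

lemma isomorphic_annihilators_imp:
  assumes "algebra_isomorphic s1 m1 s2 m2"
  shows "annihilators_square_zero m1 \<Longrightarrow> annihilators_square_zero m2"
    and "annihilators_multiply_to_zero m1 \<Longrightarrow> annihilators_multiply_to_zero m2"
proof -
  obtain f where f: "Vector_Spaces.linear s1 s2 f" "bij f" "\<And>x y. f (m1 x y) = m2 (f x) (f y)"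
    using assms by (auto simp: algebra_isomorphic_def)
  interpret Vector_Spaces.linear s1 s2 f by (rule f(1))
  define g where "g = inv f"
  have fg: "f (g y) = y" for y using f(2) by (simp add: g_def bij_is_surj surj_f_inv_f)
  have m2: "m2 x y = f (m1 (g x) (g y))" for x y by (simp add: f(3) fg)
  have gf: "g (f x) = x" for x using f(2) by (simp add: g_def bij_is_inj)
  have annihilates: "annihilates_square m1 (g w)" if "annihilates_square m2 w" for w
    unfolding annihilates_square_def
  proof (intro allI)
    fix a b
    have "f (m1 (g w) (m1 a b)) = 0"
      using that by (simp add: annihilates_square_def f(3) fg)
    then show "m1 (g w) (m1 a b) = 0" by (metis gf zero)
  qed
  show "annihilators_square_zero m1 \<Longrightarrow> annihilators_square_zero m2"
    using annihilates by (simp add: annihilators_square_zero_def m2 zero)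
  show "annihilators_multiply_to_zero m1 \<Longrightarrow> annihilators_multiply_to_zero m2"
    using annihilates by (simp add: annihilators_multiply_to_zero_def m2 gf zero)
qed

lemma isomorphic_annihilators_iff:
  assumes "algebra_isomorphic s1 m1 s2 m2"
  shows "annihilators_square_zero m1 \<longleftrightarrow> annihilators_square_zero m2"
    and "annihilators_multiply_to_zero m1 \<longleftrightarrow> annihilators_multiply_to_zero m2"
  using isomorphic_annihilators_imp[OF assms]
    isomorphic_annihilators_imp[OF algebra_isomorphic_sym[OF assms]] by blast+

lemma isomorphic_dim_square_eq:
  fixes m1 m2 :: "'k::field ^ 'n \<Rightarrow> 'k ^ 'n \<Rightarrow> 'k ^ 'n"
  assumes "algebra_isomorphic (*s) m1 (*s) m2"
  shows "vec.dim (algebra_square (*s) m1) = vec.dim (algebra_square (*s) m2)"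
proof -
  obtain f where f: "Vector_Spaces.linear (*s) (*s) f" "bij f" "\<And>x y. f (m1 x y) = m2 (f x) (f y)"
    using assms by (auto simp: algebra_isomorphic_def)
  interpret Vector_Spaces.linear "(*s)" "(*s)" f by (rule f(1))
  have "f ` {m1 a b |a b. True} = {m2 a b |a b. True}"
  proof (intro subset_antisym subsetI)
    fix z assume "z \<in> {m2 a b |a b. True}"
    then obtain a' b' where z: "z = m2 a' b'" by blast
    obtain a b where "a' = f a" and "b' = f b"
      using bij_is_surj[OF f(2)] by (meson surjD)
    with z have "z = m2 (f a) (f b)" by simp
    then have "z = f (m1 a b)" by (simp add: f(3))
    then show "z \<in> f ` {m1 a b |a b. True}" by blast
  next
    fix z assume "z \<in> f ` {m1 a b |a b. True}"
    then show "z \<in> {m2 a b |a b. True}" using f(3) by blast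
  qed
  moreover have "vec.span (f ` {m1 a b |a b. True}) = f ` vec.span {m1 a b |a b. True}"
    by (rule span_image)
  ultimately have "algebra_square (*s) m2 = f ` algebra_square (*s) m1"
    by (simp only: algebra_square_def)
  moreover have "inj_on f (vec.span (algebra_square (*s) m1))"
    by (rule inj_on_subset[OF bij_is_inj[OF f(2)]]) simp
  ultimately show ?thesis
    by (simp only: vec.dim_image_eq[OF f(1)])
qed

lemma classification_list_nonisomorphic:
  fixes L :: "('k::field ^ 6 \<Rightarrow> 'k ^ 6 \<Rightarrow> 'k ^ 6) list"
  assumes "(2 :: 'k) \<noteq> 0" and L: "L = classification_list"
    and "m < length L" and "n < length L" and iso: "algebra_isomorphic (*s) (L ! m) (*s) (L ! n)"
  shows "m = n"
proof -
  have "m \<in> {0, 1, 2, 3, 4}" "n \<in> {0, 1, 2, 3, 4}"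
    using assms by (auto simp: L classification_list_def)
  then show ?thesis
    using isomorphic_dim_square_eq[OF iso] isomorphic_annihilators_iff[OF iso]
    by (auto simp: L classification_list_def dim_A1_6_square dim_A2_6_square
        A2_6_annihilators_square_zero_iff[OF assms(1)]
        A2_6_annihilators_multiply_to_zero_iff[OF assms(1)])
qed


context jj_algebra_findim
begin

section \<open>Algebras with a prescribed multiplication table\<close>

lemma mul_sum_left: "(\<Sum>i\<in>I. f i) \<cdot> y = (\<Sum>i\<in>I. f i \<cdot> y)"
  by (induction I rule: infinite_finite_induct) (simp_all add: mul_linear)

lemma mul_sum_right: "x \<cdot> (\<Sum>i\<in>I. f i) = (\<Sum>i\<in>I. x \<cdot> f i)"
  by (induction I rule: infinite_finite_induct) (simp_all add: mul_linear)

text \<open>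
  The isomorphism sends a coordinate vector \<open>x\<close> to \<open>\<Sum>k. x\<^sub>k b\<^sub>k\<close>. Its surjectivity is the
  spanning hypothesis, and equality of dimensions gives injectivity.
\<close>

lemma isomorphic_table_mul:
  fixes b :: "'n::finite \<Rightarrow> 'a" and T :: "'n \<Rightarrow> 'n \<Rightarrow> 'k ^ 'n"
  assumes span: "span (range b) = UNIV" and dim: "dim (UNIV :: 'a set) = CARD('n)"
    and table: "\<And>i j. b i \<cdot> b j = (\<Sum>k\<in>UNIV. T i j $ k \<odot> b k)"
  shows "algebra_isomorphic smul (\<cdot>) (*s) (table_mul T)"
proof -
  interpret pair: finite_dimensional_vector_space_pair "(*s) :: 'k \<Rightarrow> 'k ^ 'n \<Rightarrow> _" cart_basis smul Basis
    by unfold_locales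
  define f where "f x = (\<Sum>k\<in>UNIV. x $ k \<odot> b k)" for x :: "'k ^ 'n"
  have add: "f (x + y) = f x + f y" for x y
    by (simp add: f_def scale_left_distrib sum.distrib)
  have scale: "f (c *s x) = c \<odot> f x" for c x
    by (simp add: f_def scale_sum_right)
  have lin: "Vector_Spaces.linear (*s) smul f"
    by (simp add: Vector_Spaces.linear_iff add scale vec.vector_space_axioms vector_space_axioms)
  interpret f: Vector_Spaces.linear "(*s)" smul f by (rule lin)
  have "b i = f (axis i 1)" for i
    by (simp add: f_def axis_def if_distrib[of "\<lambda>c. c \<odot> _"] cong: if_cong)
  then have "range b \<subseteq> range f" by blast
  then have "span (range b) \<subseteq> range f"
    by (intro span_minimal f.subspace_image) simp_all
  then have surj: "surj f" using span by blast
  have "dim (UNIV :: 'a set) = vec.dim (UNIV :: ('k ^ 'n) set)"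
    by (simp only: dim vec.dim_UNIV card_cart_basis)
  then have "inj f"
    by (rule pair.linear_surjective_imp_injective[OF lin surj])
  moreover have "f (table_mul T x y) = f x \<cdot> f y" for x y
  proof -
    have "f x \<cdot> f y = (\<Sum>i\<in>UNIV. \<Sum>j\<in>UNIV. (x $ i * y $ j) \<odot> (b i \<cdot> b j))"
      by (simp only: f_def mul_sum_left) (simp add: mul_sum_right mul_linear scale_sum_right mult.commute)
    also have "\<dots> = (\<Sum>i\<in>UNIV. \<Sum>j\<in>UNIV. (x $ i * y $ j) \<odot> f (T i j))"
      by (simp add: table f_def)
    also have "\<dots> = f (table_mul T x y)"
      by (simp add: table_mul_def f.sum f.scale)
    finally show ?thesis ..
  qed
  ultimately have "algebra_isomorphic (*s) (table_mul T) smul (\<cdot>)"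
    using lin surj by (auto simp: algebra_isomorphic_def bij_def)
  then show ?thesis by (rule algebra_isomorphic_sym)
qed

text \<open>
  The two criteria that follow trade the table for the few products that have to be computed:
  commutativity gives the transposed entries, and \<open>e\<^sub>6\<close> and products inside \<open>A\<^sup>2\<close> account for most zeros.
\<close>

lemma isomorphic_A1_6I:
  assumes dim: "dim (UNIV :: 'a set) = 6" and span: "span {e1, e2, e3, e4, e5, e6} = UNIV"
    and "e1 \<cdot> e1 = e2" "e1 \<cdot> e3 = e5" "e1 \<cdot> e4 = e6" "e3 \<cdot> e3 = e4" "e3 \<cdot> e5 = (- 1 / 2) \<odot> e6"
    and "e1 \<cdot> e2 = 0" "e1 \<cdot> e5 = 0" "e3 \<cdot> e2 = 0" "e3 \<cdot> e4 = 0"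
    and e6: "\<And>x. x \<cdot> e6 = 0"
    and sq: "\<And>x y. x \<in> {e2, e4, e5} \<Longrightarrow> y \<in> {e2, e4, e5} \<Longrightarrow> x \<cdot> y = 0"
  shows "algebra_isomorphic smul (\<cdot>) (*s) A1_6"
  unfolding A1_6_def
proof (rule isomorphic_table_mul)
  define b :: "6 \<Rightarrow> 'a" where "b i = (if i = 1 then e1 else if i = 2 then e2 else if i = 3 then e3
    else if i = 4 then e4 else if i = 5 then e5 else e6)" for i
  have b: "b 1 = e1" "b 2 = e2" "b 3 = e3" "b 4 = e4" "b 5 = e5" "b 6 = e6"
    by (simp_all add: b_def)
  have "range b = {e1, e2, e3, e4, e5, e6}"
    by (simp add: UNIV_6 b insert_commute)
  with span show "span (range b) = UNIV" by simp
  have comm: "e3 \<cdot> e1 = e1 \<cdot> e3" "e4 \<cdot> e1 = e1 \<cdot> e4" "e5 \<cdot> e3 = e3 \<cdot> e5" "e2 \<cdot> e1 = e1 \<cdot> e2"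
    "e5 \<cdot> e1 = e1 \<cdot> e5" "e2 \<cdot> e3 = e3 \<cdot> e2" "e4 \<cdot> e3 = e3 \<cdot> e4"
    by (rule mul_commute)+
  have "e6 \<cdot> x = 0" for x using e6 by (metis mul_commute)
  then show "b i \<cdot> b j = (\<Sum>k\<in>UNIV. (if (i, j) = (1, 1) then axis 2 1
     else if (i, j) \<in> {(1, 3), (3, 1)} then axis 5 1
     else if (i, j) \<in> {(1, 4), (4, 1)} then axis 6 1
     else if (i, j) = (3, 3) then axis 4 1
     else if (i, j) \<in> {(3, 5), (5, 3)} then (- 1 / 2) *s axis 6 1
     else 0) $ k \<odot> b k)" for i j
    using exhaust_6[of i] exhaust_6[of j]
    by (elim disjE) (simp_all add: sum_6 b assms comm axis_def)
qed (use dim in simp)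

lemma isomorphic_A2_6I:
  assumes dim: "dim (UNIV :: 'a set) = 6" and span: "span {e1, e2, e3, e4, e5, e6} = UNIV"
    and "e1 \<cdot> e1 = e2" "e1 \<cdot> e3 = (- \<beta>) \<odot> e2" "e1 \<cdot> e4 = e5" "e1 \<cdot> e5 = (- 1 / 2) \<odot> e6"
      "e2 \<cdot> e4 = e6" "e3 \<cdot> e3 = \<delta> \<odot> e6" "e3 \<cdot> e5 = \<beta> \<odot> e6"
    and "e1 \<cdot> e2 = 0" "e3 \<cdot> e2 = 0" "e3 \<cdot> e4 = 0" "e4 \<cdot> e4 = 0" "e4 \<cdot> e5 = 0"
    and e6: "\<And>x. x \<cdot> e6 = 0"
    and sq: "\<And>x y. x \<in> {e2, e5} \<Longrightarrow> y \<in> {e2, e5} \<Longrightarrow> x \<cdot> y = 0"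
  shows "algebra_isomorphic smul (\<cdot>) (*s) (A2_6 \<beta> \<delta>)"
  unfolding A2_6_def
proof (rule isomorphic_table_mul)
  define b :: "6 \<Rightarrow> 'a" where "b i = (if i = 1 then e1 else if i = 2 then e2 else if i = 3 then e3
    else if i = 4 then e4 else if i = 5 then e5 else e6)" for i
  have b: "b 1 = e1" "b 2 = e2" "b 3 = e3" "b 4 = e4" "b 5 = e5" "b 6 = e6"
    by (simp_all add: b_def)
  have "range b = {e1, e2, e3, e4, e5, e6}"
    by (simp add: UNIV_6 b insert_commute)
  with span show "span (range b) = UNIV" by simp
  have comm: "e3 \<cdot> e1 = e1 \<cdot> e3" "e4 \<cdot> e1 = e1 \<cdot> e4" "e5 \<cdot> e1 = e1 \<cdot> e5" "e4 \<cdot> e2 = e2 \<cdot> e4"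
    "e5 \<cdot> e3 = e3 \<cdot> e5" "e2 \<cdot> e1 = e1 \<cdot> e2" "e2 \<cdot> e3 = e3 \<cdot> e2" "e4 \<cdot> e3 = e3 \<cdot> e4" "e5 \<cdot> e4 = e4 \<cdot> e5"
    by (rule mul_commute)+
  have "e6 \<cdot> x = 0" for x using e6 by (metis mul_commute)
  then show "b i \<cdot> b j = (\<Sum>k\<in>UNIV. (if (i, j) = (1, 1) then axis 2 1
     else if (i, j) \<in> {(1, 3), (3, 1)} then (- \<beta>) *s axis 2 1
     else if (i, j) \<in> {(1, 4), (4, 1)} then axis 5 1
     else if (i, j) \<in> {(1, 5), (5, 1)} then (- 1 / 2) *s axis 6 1
     else if (i, j) \<in> {(2, 4), (4, 2)} then axis 6 1
     else if (i, j) = (3, 3) then \<delta> *s axis 6 1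
     else if (i, j) \<in> {(3, 5), (5, 3)} then \<beta> *s axis 6 1
     else 0) $ k \<odot> b k)" for i j
    using exhaust_6[of i] exhaust_6[of j]
    by (elim disjE) (simp_all add: sum_6 b assms comm axis_def)
qed (use dim in simp)

section \<open>The trilinear form of a non-associative algebra\<close>

text \<open>
  A linear coordinate on \<open>A\<^sup>3/A\<^sup>4\<close>. It turns the product of three elements into the scalar trilinear
  form \<open>\<theta>(u(vw))\<close>, so that no quotient space is needed. The form is symmetric in \<open>v, w\<close>, has vanishing
  cyclic sums, and vanishes as soon as one argument lies in \<open>A\<^sup>2\<close>.
\<close>

definition cubic_functional :: "('a \<Rightarrow> 'k) \<Rightarrow> bool"
  where "cubic_functional \<theta> \<longleftrightarrow> Vector_Spaces.linear smul (*) \<theta> \<and>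
     (\<forall>r\<in>P4. \<theta> r = 0) \<and> (\<exists>q\<in>P3. \<theta> q \<noteq> 0)"

text \<open>
  If \<open>A\<^sup>3 = 0\<close>, then both \<open>(xy)z\<close> and \<open>x(yz)\<close> vanish and the algebra is associative. Otherwise
  nilpotency makes \<open>A\<^sup>4\<close> a proper subspace of \<open>A\<^sup>3\<close>.
\<close>

lemma exists_cubic_functional:
  assumes "\<not> associative (\<cdot>)"
  obtains \<theta> where "cubic_functional \<theta>"
proof -
  have "P4 \<noteq> P3"
    using assms P3_zero_imp_associative products_eq_self_imp_zero[of P3] by auto
  then obtain q where q: "q \<in> P3" "q \<notin> P4"
    using P4_subset_P3 by blast
  then obtain \<theta> where "Vector_Spaces.linear smul (*) \<theta>" and "\<And>n. n \<in> P4 \<Longrightarrow> \<theta> n = 0" and "\<theta> q = (1::'k)"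
    using exists_functional[of P4 q] by auto
  with q have "cubic_functional \<theta>"
    by (auto simp: cubic_functional_def intro!: bexI[of _ q])
  then show thesis by (rule that)
qed

context
  fixes \<theta> :: "'a \<Rightarrow> 'k"
  assumes \<theta>: "cubic_functional \<theta>"
begin

lemma functional_linear: "Vector_Spaces.linear smul (*) \<theta>"
  using \<theta> by (simp add: cubic_functional_def)

lemma functional_add: "\<theta> (x + y) = \<theta> x + \<theta> y"
  using functional_linear by (simp add: Vector_Spaces.linear_iff)

lemma functional_scale: "\<theta> (c \<odot> x) = c * \<theta> x"
  using functional_linear by (simp add: Vector_Spaces.linear_iff)

lemma functional_zero [simp]: "\<theta> 0 = 0"
  using functional_scale[of 0 0] by simp

lemma functional_minus: "\<theta> (- x) = - \<theta> x"
  using functional_scale[of "-1" x] by simp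

lemma functional_diff: "\<theta> (x - y) = \<theta> x - \<theta> y"
  using functional_add[of x "- y"] by (simp add: functional_minus)

lemmas functional_simps = functional_add functional_scale functional_minus functional_diff functional_zero

lemma functional_P4: "r \<in> P4 \<Longrightarrow> \<theta> r = 0"
  using \<theta> by (simp add: cubic_functional_def)

lemma functional_mul_P3: "q \<in> P3 \<Longrightarrow> \<theta> (u \<cdot> q) = 0"
  by (simp add: functional_P4)

lemma functional_P2_P2: "p \<in> P2 \<Longrightarrow> p' \<in> P2 \<Longrightarrow> \<theta> (p \<cdot> p') = 0"
  by (simp add: functional_P4 P2_mul_P2)

lemma functional_square_mul: "\<theta> (y \<cdot> (x \<cdot> x)) = - 2 * \<theta> (x \<cdot> (x \<cdot> y))"
  using square_mul[of x y] mul_commute[of y "x \<cdot> x"] by (simp add: functional_simps)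

lemma subspace_functional_kernel: "subspace {z. \<theta> z = 0}"
  by (auto intro!: subspaceI simp: functional_simps)

lemma subspace_functional_mul_kernel: "subspace {z. \<theta> (g \<cdot> z) = 0}"
  by (auto intro!: subspaceI simp: functional_simps mul_linear)

lemma functional_form_neq_zero: "\<exists>u v w. \<theta> (u \<cdot> (v \<cdot> w)) \<noteq> 0"
proof (rule ccontr)
  assume "\<not> ?thesis"
  then have zero: "\<theta> (u \<cdot> (v \<cdot> w)) = 0" for u v w by blast
  have "\<theta> (u \<cdot> p) = 0" if "p \<in> P2" for u p
  proof -
    have "P2 \<subseteq> {z. \<theta> (u \<cdot> z) = 0}"
      by (rule products_subsetI[OF subspace_functional_mul_kernel]) (simp add: zero)
    with that show ?thesis by blast
  qed
  then have "P3 \<subseteq> {z. \<theta> z = 0}"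
    by (intro products_subsetI[OF subspace_functional_kernel]) simp
  then show False using \<theta> by (auto simp: cubic_functional_def)
qed

text \<open>
  If all products were multiples of a single \<open>p\<close> up to elements that the form does not see, the form
  would be \<open>\<theta>(u(vw)) = s(v,w) \<lambda>(u)\<close>. Choose \<open>w\<close> with \<open>\<lambda>(w) \<noteq> 0\<close>. Then \<open>w(ww) = 0\<close> gives \<open>s(w,w) = 0\<close>, its
  polarisation gives \<open>s(w,u) = 0\<close> for all \<open>u\<close>, and the Jacobi identity of \<open>w, u, v\<close> gives
  \<open>s(u,v) = 0\<close>. So the form would be zero.
\<close>

lemma P2_not_one_dimensional:
  assumes "subspace K" and K_zero: "\<And>u k. k \<in> K \<Longrightarrow> \<theta> (u \<cdot> k) = 0"
    and P2_sub: "P2 \<subseteq> span (insert p K)"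
  shows False
proof -
  have "\<exists>c. \<forall>u. \<theta> (u \<cdot> (v \<cdot> w)) = c * \<theta> (u \<cdot> p)" for v w
  proof -
    have "v \<cdot> w \<in> span (insert p K)" using P2_sub mul_in_products[of w UNIV v] by blast
    then obtain c where "v \<cdot> w - c \<odot> p \<in> K"
      using assms(1) by (metis span_breakdown_eq span_eq_iff)
    then have zero: "\<theta> (u \<cdot> (v \<cdot> w - c \<odot> p)) = 0" for u
      by (rule K_zero)
    have "\<theta> (u \<cdot> (v \<cdot> w)) = c * \<theta> (u \<cdot> p)" for u
      using zero[of u] by (simp add: functional_simps mul_linear)
    then show ?thesis by (auto simp: functional_simps mul_linear)
  qed
  then obtain s where s: "\<And>u v w. \<theta> (u \<cdot> (v \<cdot> w)) = s v w * \<theta> (u \<cdot> p)"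
    by metis
  then obtain w where w: "\<theta> (w \<cdot> p) \<noteq> 0"
    using functional_form_neq_zero by (metis mult_zero_right)
  have "s w w = 0"
    using s[of w w w] w by (simp add: cube_zero)
  then have "\<theta> (w \<cdot> (w \<cdot> u)) = 0" for u
    using functional_square_mul[of u w] s[of u w w] two_neq_zero by simp
  then have swu: "s w u = 0" for u
    using s[of w w u] w by simp
  have "s u v = 0" for u v
  proof -
    have "\<theta> (w \<cdot> (u \<cdot> v)) + \<theta> (u \<cdot> (v \<cdot> w)) + \<theta> (v \<cdot> (w \<cdot> u)) = 0"
      using arg_cong[OF jacobi[of w u v], of \<theta>] by (simp add: functional_add)
    moreover have "\<theta> (u \<cdot> (v \<cdot> w)) = 0"
      using s[of u w v] swu by (simp add: mul_commute[of v w])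
    ultimately show ?thesis
      using s[of w u v] s[of v w u] swu w by simp
  qed
  then show False using s functional_form_neq_zero by (metis mult_zero_left)
qed

lemma dim_P2_ge: "dim P3 + 2 \<le> dim P2"
proof (rule ccontr)
  assume "\<not> ?thesis"
  then obtain p where "P2 = span (insert p P3)"
    using exists_span_insert[of P3 P2] P3_subset_P2 by auto
  then show False
    using P2_not_one_dimensional[of P3 p] functional_mul_P3 by auto
qed

lemma P2_subset_span:
  assumes "span (X \<union> P2) = UNIV"
  shows "P2 \<subseteq> span ({a \<cdot> b |a b. a \<in> X \<and> b \<in> X} \<union> P3)" (is "_ \<subseteq> span ?G")
proof (rule products_subsetI)
  fix a b :: 'a
  have "u \<cdot> v \<in> span ?G" if "u \<in> X \<union> P2" "v \<in> X \<union> P2" for u v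
    using that by (intro span_base) auto
  then show "a \<cdot> b \<in> span ?G"
    by (rule mul_span_mem[OF subspace_span, where X = "X \<union> P2" and Y = "X \<union> P2"])
      (simp_all add: assms)
qed simp

lemma P3_subset_span:
  assumes "span (X \<union> P2) = UNIV" and "P2 \<subseteq> span (Y \<union> P3)" and "Y \<subseteq> P2"
  shows "P3 \<subseteq> span ({a \<cdot> y |a y. a \<in> X \<and> y \<in> Y} \<union> P4)" (is "_ \<subseteq> span ?G")
proof (rule products_subsetI)
  fix a p assume "p \<in> P2"
  show "a \<cdot> p \<in> span ?G"
  proof (rule mul_span_mem)
    show "a \<in> span (X \<union> P2)" by (simp add: assms(1))
    show "p \<in> span (Y \<union> P3)" using assms(2) \<open>p \<in> P2\<close> by blast
    fix u v assume "u \<in> X \<union> P2" and v: "v \<in> Y \<union> P3"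
    then consider "u \<in> X" "v \<in> Y" | "u \<in> P2" "v \<in> P2" | "v \<in> P3"
      using assms(3) by blast
    then have "u \<cdot> v \<in> ?G"
    proof cases
      case 2
      then show ?thesis using P2_mul_P2 by simp
    qed auto
    then show "u \<cdot> v \<in> span ?G" by (rule span_base)
  qed simp
qed simp

text \<open>
  A single generator \<open>x\<close> would make \<open>A\<^sup>2\<close> spanned by \<open>xx\<close> modulo \<open>A\<^sup>3\<close>.
\<close>

lemma dim_UNIV_ge: "dim P2 + 2 \<le> dim UNIV"
proof (rule ccontr)
  assume "\<not> ?thesis"
  then obtain x where x: "span (insert x P2) = UNIV"
    using exists_span_insert[of P2 UNIV] by fastforce
  have "P2 \<subseteq> span (insert (x \<cdot> x) P3)"
    using P2_subset_span[of "{x}"] x by simp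
  then show False
    using P2_not_one_dimensional[of P3 "x \<cdot> x"] functional_mul_P3 by auto
qed

text \<open>
  The form vanishes as soon as one argument lies in \<open>W\<close>, so it lives on the plane spanned by \<open>x\<close>
  and \<open>y\<close>. On a plane it has the shape \<open>\<theta>(u(vw)) = \<omega>(u,v) m(w) + \<omega>(u,w) m(v)\<close> with \<open>\<omega>\<close> alternating and \<open>m\<close>
  linear. The pair is adapted to the form when \<open>y'\<close> spans the kernel of \<open>m\<close>.
\<close>

lemma exists_adapted_pair:
  assumes gen: "span (insert x (insert y W)) = UNIV"
    and W: "\<And>w a b. w \<in> W \<Longrightarrow> \<theta> (w \<cdot> (a \<cdot> b)) = 0" "\<And>w a b. w \<in> W \<Longrightarrow> \<theta> (a \<cdot> (w \<cdot> b)) = 0"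
  obtains x' y' where "span (insert x' (insert y' W)) = UNIV"
    and "\<theta> (y' \<cdot> (x' \<cdot> y')) = 0" and "\<theta> (x' \<cdot> (x' \<cdot> y')) \<noteq> 0"
proof -
  have nonzero: "\<theta> (x' \<cdot> (x' \<cdot> y')) \<noteq> 0"
    if gen': "span (insert x' (insert y' W)) = UNIV" and zero: "\<theta> (y' \<cdot> (x' \<cdot> y')) = 0" for x' y'
  proof
    assume zero': "\<theta> (x' \<cdot> (x' \<cdot> y')) = 0"
    let ?X = "insert x' (insert y' W)"
    have W3: "\<theta> (a \<cdot> (b \<cdot> w)) = 0" if "w \<in> W" for a b w
      using W(2)[OF that, of a b] by (simp only: mul_commute[of w b])
    have "\<theta> (y' \<cdot> (y' \<cdot> x')) = 0" "\<theta> (x' \<cdot> (y' \<cdot> x')) = 0"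
      using zero zero' by (simp_all add: mul_commute[of y' x'])
    then have form_zero: "\<theta> (g \<cdot> (a \<cdot> b)) = 0" if "g \<in> ?X" "a \<in> ?X" "b \<in> ?X" for g a b
      using that zero zero' W W3 by (auto simp: cube_zero functional_square_mul)
    have step: "\<theta> (g \<cdot> (v \<cdot> w)) = 0" if "g \<in> ?X" for g v w
      using mul_span_mem[OF subspace_functional_mul_kernel[of g], of ?X ?X v w] form_zero[OF that] gen'
      by auto
    have "\<theta> (u \<cdot> (v \<cdot> w)) = 0" for u v w
      using mul_span_mem[OF subspace_functional_kernel, of ?X "{v \<cdot> w}" u "v \<cdot> w"] step gen'
      by (auto simp: span_base)
    then show False using functional_form_neq_zero by blast
  qed
  show thesis
  proof (cases "\<theta> (y \<cdot> (x \<cdot> y)) = 0")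
    case True
    then show thesis using that[OF gen] nonzero[OF gen] by blast
  next
    case False
    \<comment> \<open>With \<open>x' = y\<close> and \<open>y' = x + c y\<close> the value \<open>\<theta>(y'(x'y'))\<close> is \<open>\<theta>(x(xy)) - c \<theta>(y(xy))\<close>.\<close>
    define c where "c = \<theta> (x \<cdot> (x \<cdot> y)) / \<theta> (y \<cdot> (x \<cdot> y))"
    let ?y = "x + c \<odot> y"
    have "\<theta> (y \<cdot> (y \<cdot> x)) = \<theta> (y \<cdot> (x \<cdot> y))" "\<theta> (x \<cdot> (y \<cdot> x)) = \<theta> (x \<cdot> (x \<cdot> y))"
      by (simp_all add: mul_commute[of y x])
    then have zero: "\<theta> (?y \<cdot> (y \<cdot> ?y)) = 0"
      using False
      by (simp add: functional_simps mul_linear cube_zero functional_square_mul c_def)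
    have "x = ?y - c \<odot> y" by simp
    then have "x \<in> span (insert y (insert ?y W))"
      by (metis insertI1 insertI2 span_base span_diff span_scale)
    then have "insert x (insert y W) \<subseteq> span (insert y (insert ?y W))"
      by (auto intro: span_base)
    then have "span (insert y (insert ?y W)) = UNIV"
      using gen span_minimal[OF _ subspace_span] by (metis top.extremum_uniqueI)
    then show thesis using that zero nonzero by blast
  qed
qed

lemma dim_P3_pos: "0 < dim P3"
proof (rule ccontr)
  assume "\<not> ?thesis"
  then have "P3 \<subseteq> {0}" by simp
  then show False
    using \<theta> functional_zero unfolding cubic_functional_def by blast
qed

lemma P4_eq_zero:
  assumes "dim P3 = 1"
  shows "P4 = {0}"
proof -
  have "P4 \<noteq> P3"
    using \<theta> unfolding cubic_functional_def by blast
  with P4_subset_P3 have "span P4 \<subset> span P3"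
    by (simp add: span_eq_iff[THEN iffD2] psubset_eq)
  from dim_psubset[OF this] assms have "dim P4 = 0" by linarith
  then have "P4 \<subseteq> {0}" by (simp only: dim_eq_0)
  then show ?thesis
    using subspace_0[OF subspace_products] by blast
qed

lemma P2_mul_P2_zero: "dim P3 = 1 \<Longrightarrow> p \<in> P2 \<Longrightarrow> p' \<in> P2 \<Longrightarrow> p \<cdot> p' = 0"
  using P2_mul_P2 P4_eq_zero by blast

lemma mul_P3_zero: "dim P3 = 1 \<Longrightarrow> q \<in> P3 \<Longrightarrow> a \<cdot> q = 0"
  using mul_in_products[of q P3 a] P4_eq_zero by blast

lemma P3_eq_span:
  assumes "dim P3 = 1" and "q \<in> P3" and "q \<noteq> 0"
  shows "P3 = span {q}"
proof (rule subspace_dim_equal[symmetric])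
  show "span {q} \<subseteq> P3" using assms(2) by (intro span_minimal) auto
qed (use assms in auto)

text \<open>
  When \<open>A\<^sup>3\<close> is a line, \<open>\<theta>\<close> is injective on it, and an identity between vectors of \<open>A\<^sup>3\<close> becomes an
  identity between scalars.
\<close>

lemma P3_eqI:
  assumes "dim P3 = 1" and "z \<in> P3" and "z' \<in> P3" and "\<theta> z = \<theta> z'"
  shows "z = z'"
proof -
  obtain q where q: "q \<in> P3" "\<theta> q \<noteq> 0"
    using \<theta> unfolding cubic_functional_def by blast
  then have "P3 = span {q}"
    using P3_eq_span[OF assms(1)] functional_zero by metis
  with assms(2,3) obtain c c' where "z = c \<odot> q" "z' = c' \<odot> q"
    by (auto simp: span_singleton)
  with assms(4) q(2) show ?thesis by (simp add: functional_simps)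
qed

lemma P3_eq_zeroI: "dim P3 = 1 \<Longrightarrow> z \<in> P3 \<Longrightarrow> \<theta> z = 0 \<Longrightarrow> z = 0"
  using P3_eqI[of z 0] subspace_0[OF subspace_products] functional_zero by simp

section \<open>Algebras with \<open>dim A\<^sup>2 = 4\<close>\<close>

text \<open>
  Suppose \<open>yy \<in> A\<^sup>3\<close> and put \<open>a = x(xy)\<close>. Then \<open>a\<close> spans \<open>A\<^sup>3\<close> modulo \<open>A\<^sup>4\<close>. Moreover \<open>x a = 0\<close>, and
  \<open>4 y a = (yy)(xx)\<close> lies in \<open>A A\<^sup>4\<close>. Hence \<open>A\<^sup>4 = A A\<^sup>4\<close>, so \<open>A\<^sup>4 = 0\<close>, and \<open>xx\<close>, \<open>xy\<close>, \<open>a\<close> already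
  span \<open>A\<^sup>2\<close>, which has dimension \<open>4\<close>.
\<close>

lemma square_notin_P3:
  assumes gen: "span (insert x (insert y P2)) = UNIV" and "dim P2 = 4"
    and zero: "\<theta> (y \<cdot> (x \<cdot> y)) = 0" and nonzero: "\<theta> (x \<cdot> (x \<cdot> y)) \<noteq> 0"
  shows "y \<cdot> y \<notin> P3"
proof
  assume yy: "y \<cdot> y \<in> P3"
  let ?a = "x \<cdot> (x \<cdot> y)"
  have gen': "span ({x, y} \<union> P2) = UNIV" using gen by simp
  let ?Y = "{x \<cdot> x, x \<cdot> y}"
  have P2_sub: "P2 \<subseteq> span (?Y \<union> P3)"
  proof -
    have "a \<cdot> b \<in> ?Y \<union> P3" if "a \<in> {x, y}" "b \<in> {x, y}" for a b
      using that yy mul_commute[of y x] by auto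
    then have "{a \<cdot> b |a b. a \<in> {x, y} \<and> b \<in> {x, y}} \<union> P3 \<subseteq> span (?Y \<union> P3)"
      using span_superset[of "?Y \<union> P3"] by blast
    then show ?thesis
      using P2_subset_span[OF gen'] span_minimal[OF _ subspace_span] by blast
  qed
  have yyx: "y \<cdot> (x \<cdot> y) \<in> P4"
  proof -
    have "(y \<cdot> y) \<cdot> x \<in> P4" using yy by simp
    then show ?thesis
      using mul_mul_self[of y x] by (simp only: mul_commute[of x y] subspace_scale subspace_products)
  qed
  have P3_sub: "P3 \<subseteq> span (insert ?a P4)"
  proof -
    have "y \<cdot> (x \<cdot> x) = (- 2) \<odot> ?a"
      using square_mul_scale[of x y] by (simp add: mul_commute[of y "x \<cdot> x"])
    then have "y \<cdot> (x \<cdot> x) \<in> span (insert ?a P4)"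
      by (simp add: span_base span_scale span_neg)
    then have "g \<cdot> h \<in> span (insert ?a P4)" if "g \<in> {x, y}" "h \<in> ?Y" for g h
      using that yyx by (auto simp: cube_zero span_base span_zero)
    then have "{g \<cdot> h |g h. g \<in> {x, y} \<and> h \<in> ?Y} \<union> P4 \<subseteq> span (insert ?a P4)"
      using span_superset[of "insert ?a P4"] by blast
    then have "span ({g \<cdot> h |g h. g \<in> {x, y} \<and> h \<in> ?Y} \<union> P4) \<subseteq> span (insert ?a P4)"
      by (rule span_minimal[OF _ subspace_span])
    moreover have "?Y \<subseteq> P2" by simp
    ultimately show ?thesis
      using P3_subset_span[OF gen' P2_sub] by blast
  qed
  have ya: "y \<cdot> ?a \<in> products P4"
  proof -
    have "(y \<cdot> y) \<cdot> (x \<cdot> x) = 4 \<odot> (y \<cdot> ?a)"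
      using square_mul_scale[of x y]
      by (simp add: square_mul_scale[of y] mul_commute[of y "x \<cdot> x"] mul_linear)
    moreover have "(x \<cdot> x) \<cdot> (y \<cdot> y) \<in> products P4"
      using yy by (intro P2_mul_P3) simp_all
    ultimately have "(1 / 4) \<odot> (4 \<odot> (y \<cdot> ?a)) \<in> products P4"
      by (metis mul_commute subspace_products subspace_scale)
    then show ?thesis using four_neq_zero[OF two_neq_zero] by simp
  qed
  have "P4 \<subseteq> products P4"
  proof (rule products_subsetI)
    fix u q assume "q \<in> P3"
    show "u \<cdot> q \<in> products P4"
    proof (rule mul_span_mem[OF subspace_products, where X = "insert x (insert y P2)" and Y = "insert ?a P4"])
      show "u \<in> span (insert x (insert y P2))" by (simp add: gen)
      show "q \<in> span (insert ?a P4)" using P3_sub \<open>q \<in> P3\<close> by blast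
      fix g h assume "g \<in> insert x (insert y P2)" "h \<in> insert ?a P4"
      moreover have "p \<cdot> ?a \<in> products P4" if "p \<in> P2" for p
        using that by (intro P2_mul_P3) simp_all
      ultimately show "g \<cdot> h \<in> products P4"
        using ya by (auto simp: mul_self_cubed subspace_0)
    qed
  qed simp
  moreover have "products P4 \<subseteq> P4"
    by (rule products_mono[OF P4_subset_P3])
  ultimately have "P4 = {0}"
    by (intro products_eq_self_imp_zero) simp_all
  then have "P3 \<subseteq> span {x \<cdot> x, x \<cdot> y, ?a}"
    using P3_sub span_mono[of "{?a}" "{x \<cdot> x, x \<cdot> y, ?a}"] by (auto simp: insert_commute)
  moreover have "?Y \<subseteq> span {x \<cdot> x, x \<cdot> y, ?a}"
    by (simp add: span_base)
  ultimately have "P2 \<subseteq> span {x \<cdot> x, x \<cdot> y, ?a}"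
    using P2_sub span_minimal[OF _ subspace_span] by (meson Un_least subset_trans)
  then have "dim P2 \<le> card {x \<cdot> x, x \<cdot> y, ?a}"
    by (intro dim_le_card) simp_all
  also have "\<dots> \<le> 3" by (simp add: card_insert_if)
  finally show False using \<open>dim P2 = 4\<close> by simp
qed

text \<open>
  The algebra is generated by an adapted pair \<open>x, y\<close>. In the notation of the table \<open>y\<close> is \<open>e\<^sub>1\<close> and
  \<open>x\<close> is \<open>e\<^sub>3\<close>: the equation \<open>e\<^sub>1 e\<^sub>5 = 0\<close> is \<open>\<theta>(y(xy)) = 0\<close>, and all other products follow from the identities.
\<close>

lemma isomorphic_A1_6_if_dim_P2_4:
  assumes dim: "dim (UNIV :: 'a set) = 6" and "dim P2 = 4"
  shows "algebra_isomorphic smul (\<cdot>) (*s) A1_6"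
proof -
  obtain u v where u: "span (insert u (insert v P2)) = UNIV"
    using exists_span_insert_two[of P2] assms by auto
  obtain x y where gen: "span (insert x (insert y P2)) = UNIV"
    and zero: "\<theta> (y \<cdot> (x \<cdot> y)) = 0" and nonzero: "\<theta> (x \<cdot> (x \<cdot> y)) \<noteq> 0"
    using exists_adapted_pair[OF u] functional_P2_P2 functional_mul_P3
    by (metis UNIV_I mul_in_products mul_in_products')
  have theta_x_yy: "\<theta> (x \<cdot> (y \<cdot> y)) = 0" and theta_y_xx: "\<theta> (y \<cdot> (x \<cdot> x)) \<noteq> 0"
    using zero nonzero two_neq_zero functional_square_mul[of x y]
      functional_square_mul[of y x] by (simp_all add: mul_commute[of x y])
  have P3_span: "span P3 = P3" by (simp add: span_eq_iff[THEN iffD2])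
  have yy: "y \<cdot> y \<notin> P3"
    by (rule square_notin_P3[OF gen \<open>dim P2 = 4\<close> zero nonzero])
  have "span (insert (y \<cdot> y) P3) \<subseteq> {z. \<theta> (x \<cdot> z) = 0}"
    using theta_x_yy by (intro span_minimal subspace_functional_mul_kernel)
      (auto simp: functional_mul_P3)
  then have xy: "x \<cdot> y \<notin> span (insert (y \<cdot> y) P3)" using nonzero by blast
  have "span (insert (x \<cdot> y) (insert (y \<cdot> y) P3)) \<subseteq> {z. \<theta> (y \<cdot> z) = 0}"
    using zero by (intro span_minimal subspace_functional_mul_kernel)
      (auto simp: functional_mul_P3 cube_zero functional_zero)
  then have xx: "x \<cdot> x \<notin> span (insert (x \<cdot> y) (insert (y \<cdot> y) P3))" using theta_y_xx by blast
  \<comment> \<open>The functionals \<open>\<theta>(x -)\<close> and \<open>\<theta>(y -)\<close> vanish on \<open>A\<^sup>3\<close> and separate \<open>xx, xy, yy\<close>, which leaves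
    only one dimension for \<open>A\<^sup>3\<close>.\<close>
  have "dim (insert (x \<cdot> x) (insert (x \<cdot> y) (insert (y \<cdot> y) P3))) = dim P3 + 3"
    using xx xy yy by (simp add: dim_insert P3_span)
  moreover have "insert (x \<cdot> x) (insert (x \<cdot> y) (insert (y \<cdot> y) P3)) \<subseteq> P2"
    using P3_subset_P2 by simp
  ultimately have "dim P3 + 3 \<le> 4"
    using dim_subset \<open>dim P2 = 4\<close> by metis
  then have dim_P3: "dim P3 = 1" using dim_P3_pos by simp
  let ?e6 = "y \<cdot> (x \<cdot> x)"
  let ?S = "span {y, y \<cdot> y, x, x \<cdot> x, y \<cdot> x, ?e6}"
  have "?e6 \<noteq> 0" using theta_y_xx functional_zero by metis
  then have P3_eq: "P3 = span {?e6}"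
    by (intro P3_eq_span[OF dim_P3]) simp_all
  have "P3 \<subseteq> ?S" unfolding P3_eq by (intro span_mono) simp
  moreover have "{a \<cdot> b |a b. a \<in> {x, y} \<and> b \<in> {x, y}} \<subseteq> ?S"
    by (auto simp: mul_commute[of x y] intro: span_base)
  moreover have "P2 \<subseteq> span ({a \<cdot> b |a b. a \<in> {x, y} \<and> b \<in> {x, y}} \<union> P3)"
    using gen by (intro P2_subset_span) simp
  ultimately have "P2 \<subseteq> ?S"
    using span_minimal[OF _ subspace_span] by (meson Un_least subset_trans)
  then have "insert x (insert y P2) \<subseteq> ?S" by (simp add: span_base)
  then have span: "?S = UNIV"
    using gen span_minimal[OF _ subspace_span] by (metis top.extremum_uniqueI)
  have x_yx: "x \<cdot> (y \<cdot> x) = (- 1 / 2) \<odot> ?e6"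
    using mul_mul_self[of x y] by (simp only: mul_commute[of y x] mul_commute[of y "x \<cdot> x"])
  have y_yx: "y \<cdot> (y \<cdot> x) = 0"
    using zero by (intro P3_eq_zeroI[OF dim_P3]) (simp_all add: mul_commute[of y x])
  have x_yy: "x \<cdot> (y \<cdot> y) = 0"
    using theta_x_yy by (intro P3_eq_zeroI[OF dim_P3]) simp_all
  have e6: "a \<cdot> ?e6 = 0" for a
    by (intro mul_P3_zero[OF dim_P3]) simp
  have sq: "p \<cdot> p' = 0" if "p \<in> {y \<cdot> y, x \<cdot> x, y \<cdot> x}" "p' \<in> {y \<cdot> y, x \<cdot> x, y \<cdot> x}" for p p'
    using that by (intro P2_mul_P2_zero[OF dim_P3]) auto
  show ?thesis
    by (rule isomorphic_A1_6I[OF dim span refl refl refl refl x_yx cube_zero y_yx x_yy cube_zero e6 sq])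
qed

section \<open>Algebras with \<open>dim A\<^sup>2 = 3\<close>\<close>

context
  assumes dim_UNIV_6: "dim (UNIV :: 'a set) = 6" and dim_P2: "dim P2 = 3"
begin

lemma dim_P3: "dim P3 = 1"
  using dim_P2_ge dim_P3_pos dim_P2 by simp


text \<open>
  Otherwise \<open>A\<^sup>2\<close> would be spanned by one element modulo \<open>A\<^sup>3 + \<langle>p\<rangle>\<close>, which the form does not see.
\<close>

lemma P2_annihilator_in_P3:
  assumes "p \<in> P2" and "\<And>a. \<theta> (a \<cdot> p) = 0"
  shows "p \<in> P3"
proof (rule ccontr)
  assume "p \<notin> P3"
  then have "dim (span (insert p P3)) = 2"
    using dim_P3 by (simp add: dim_insert span_eq_iff[THEN iffD2])
  moreover have "span (insert p P3) \<subseteq> P2"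
    using assms(1) P3_subset_P2 by (intro span_minimal) auto
  ultimately obtain p' where p': "P2 = span (insert p' (span (insert p P3)))"
    using exists_span_insert[of "span (insert p P3)" P2] dim_P2 by auto
  have "span (insert p P3) \<subseteq> {z. \<theta> (a \<cdot> z) = 0}" for a
    using assms(2) functional_mul_P3
    by (intro span_minimal subspace_functional_mul_kernel) auto
  then show False
    using P2_not_one_dimensional[of "span (insert p P3)" p'] p' by blast
qed

text \<open>
  Let \<open>p, p'\<close> span \<open>A\<^sup>2\<close> modulo \<open>A\<^sup>3\<close>. Since \<open>\<theta>\<close> is injective on \<open>A\<^sup>3\<close>, the condition \<open>w A\<^sup>2 = 0\<close> amounts to
  the two linear equations \<open>\<theta>(wp) = \<theta>(wp') = 0\<close>. Their solutions have dimension at least \<open>4\<close>, more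
  than \<open>A\<^sup>2\<close> has.
\<close>

lemma exists_annihilator:
  "\<exists>w. w \<notin> P2 \<and> (\<forall>p\<in>P2. w \<cdot> p = 0)"
proof -
  have "P3 \<noteq> P2" using dim_P2 dim_P3 by auto
  then obtain p where p: "p \<in> P2" "p \<notin> P3"
    using P3_subset_P2 by blast
  then have "dim (span (insert p P3)) = 2"
    using dim_P3 by (simp add: dim_insert span_eq_iff[THEN iffD2])
  moreover have "span (insert p P3) \<subseteq> P2"
    using p(1) P3_subset_P2 by (intro span_minimal) auto
  ultimately obtain p' where p': "p' \<in> P2" "P2 = span (insert p' (span (insert p P3)))"
    using exists_span_insert[of "span (insert p P3)" P2] dim_P2 by auto
  have lin: "Vector_Spaces.linear smul (*) (\<lambda>z. \<theta> (z \<cdot> q))" for q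
    using functional_linear
    by (simp add: Vector_Spaces.linear_iff functional_simps mul_linear)
  interpret Vector_Spaces.linear smul "(*)" "\<lambda>z. \<theta> (z \<cdot> q)" for q by (rule lin)
  define K where "K q = {z. \<theta> (z \<cdot> q) = 0}" for q
  have "subspace (K q)" for q
    by (auto intro!: subspaceI simp: K_def functional_simps mul_linear)
  moreover have "dim (UNIV :: 'a set) \<le> dim (K p) + 1"
    using dim_inter_kernel[OF lin[of p], of UNIV] by (simp add: K_def)
  moreover have "subspace (K p) \<Longrightarrow> dim (K p) \<le> dim (K p \<inter> K p') + 1"
    using dim_inter_kernel[OF lin[of p'], of "K p"] by (simp add: K_def)
  ultimately have "dim (K p \<inter> K p') > dim P2"
    using dim_UNIV_6 dim_P2 by fastforce
  then have "\<not> K p \<inter> K p' \<subseteq> P2"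
    using dim_subset not_le by blast
  then obtain w where w: "w \<notin> P2" "\<theta> (w \<cdot> p) = 0" "\<theta> (w \<cdot> p') = 0"
    by (auto simp: K_def)
  have "span (insert p P3) \<subseteq> {z. \<theta> (w \<cdot> z) = 0}"
    using w functional_mul_P3
    by (intro span_minimal subspace_functional_mul_kernel) auto
  then have "span (insert p' (span (insert p P3))) \<subseteq> {z. \<theta> (w \<cdot> z) = 0}"
    using w by (intro span_minimal subspace_functional_mul_kernel) auto
  with p'(2) have "P2 \<subseteq> {z. \<theta> (w \<cdot> z) = 0}"
    by (rule ord_eq_le_trans)
  then have "w \<cdot> q = 0" if "q \<in> P2" for q
    using that by (intro P3_eq_zeroI[OF dim_P3]) auto
  with w(1) show ?thesis by blast
qed

text \<open>
  What remains free is the factor \<open>d\<close> in \<open>e\<^sub>3 e\<^sub>3 = d e\<^sub>6\<close>. Replacing \<open>e\<^sub>4\<close> by \<open>t e\<^sub>4\<close> multiplies \<open>e\<^sub>5\<close> and \<open>e\<^sub>6\<close> by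
  \<open>t\<close> and changes no other relation, so a nonzero \<open>d\<close> is turned into \<open>1\<close> by \<open>t = d\<close>.
\<close>

lemma isomorphic_A2_6_if_adapted_triple:
  assumes gen: "span (insert e1 (insert e3 (insert e4 P2))) = UNIV"
    and e1_e3: "e1 \<cdot> e3 = (- \<beta>) \<odot> (e1 \<cdot> e1)" and e3_e4: "e3 \<cdot> e4 = 0" and e4_e4: "e4 \<cdot> e4 = 0"
    and e3_e2: "e3 \<cdot> (e1 \<cdot> e1) = 0" and e3_e5: "e3 \<cdot> (e1 \<cdot> e4) = \<beta> \<odot> ((e1 \<cdot> e1) \<cdot> e4)"
    and e3_e3: "e3 \<cdot> e3 \<in> P3" and e6: "(e1 \<cdot> e1) \<cdot> e4 \<noteq> 0"
  shows "\<exists>\<delta>\<in>{0, 1}. algebra_isomorphic smul (\<cdot>) (*s) (A2_6 \<beta> \<delta>)"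
proof -
  let ?q = "(e1 \<cdot> e1) \<cdot> e4"
  have q_P3: "?q \<in> P3" by simp
  have P3_eq: "P3 = span {?q}"
    by (rule P3_eq_span[OF dim_P3 q_P3 e6])
  with e3_e3 obtain d where d: "e3 \<cdot> e3 = d \<odot> ?q"
    by (auto simp: span_singleton)
  have q_neq: "\<theta> ?q \<noteq> 0" using P3_eq_zeroI[OF dim_P3 q_P3] e6 by blast
  have e1_e5: "e1 \<cdot> (e1 \<cdot> e4) = (- 1 / 2) \<odot> ?q" by (rule mul_mul_self)
  have e4_e5: "e4 \<cdot> (e1 \<cdot> e4) = 0"
    using mul_mul_self[of e4 e1] by (simp add: e4_e4 mul_commute[of e1 e4])
  have "span {?q} \<subseteq> {z. \<theta> (e1 \<cdot> z) = 0}"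
    by (intro span_minimal subspace_functional_mul_kernel)
      (simp add: functional_mul_P3)
  then have e5_notin: "e1 \<cdot> e4 \<notin> span {?q}"
    using q_neq two_neq_zero e1_e5 by (auto simp: functional_simps)
  have "span {e1 \<cdot> e4, ?q} \<subseteq> {z. \<theta> (e4 \<cdot> z) = 0}"
    by (intro span_minimal subspace_functional_mul_kernel)
      (simp add: functional_mul_P3 e4_e5 functional_simps)
  then have e2_notin: "e1 \<cdot> e1 \<notin> span {e1 \<cdot> e4, ?q}"
    using q_neq mul_commute[of e4 "e1 \<cdot> e1"] by auto
  have "span {e1 \<cdot> e1, e1 \<cdot> e4, ?q} = P2"
  proof (rule subspace_dim_equal)
    show "span {e1 \<cdot> e1, e1 \<cdot> e4, ?q} \<subseteq> P2" by (intro span_minimal) simp_all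
    show "dim P2 \<le> dim (span {e1 \<cdot> e1, e1 \<cdot> e4, ?q})"
      using e2_notin e5_notin e6 dim_P2 by (simp add: dim_insert)
  qed simp_all
  define t where "t = (if d = 0 then 1 else d)"
  have "t \<noteq> 0" by (simp add: t_def)
  let ?\<delta> = "if d = 0 then 0 else 1 :: 'k"
  let ?S = "span {e1, e1 \<cdot> e1, e3, t \<odot> e4, t \<odot> (e1 \<cdot> e4), t \<odot> ?q}"
  have unscale: "x \<in> ?S" if "t \<odot> x \<in> ?S" for x
    using span_scale[OF that, of "1 / t"] \<open>t \<noteq> 0\<close> by simp
  have "{e1, e1 \<cdot> e1, e3, e4, e1 \<cdot> e4, ?q} \<subseteq> ?S"
    using unscale by (auto intro: span_base)
  moreover from this have "P2 \<subseteq> ?S"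
    unfolding \<open>span {e1 \<cdot> e1, e1 \<cdot> e4, ?q} = P2\<close>[symmetric]
    by (intro span_minimal) simp_all
  ultimately have span: "?S = UNIV"
    by (intro span_eq_UNIV_trans[OF gen]) simp
  have table: "e1 \<cdot> (t \<odot> (e1 \<cdot> e4)) = (- 1 / 2) \<odot> (t \<odot> ?q)"
    "e3 \<cdot> (t \<odot> (e1 \<cdot> e4)) = \<beta> \<odot> (t \<odot> ?q)" "e3 \<cdot> (t \<odot> e4) = 0"
    "(t \<odot> e4) \<cdot> (t \<odot> e4) = 0" "(t \<odot> e4) \<cdot> (t \<odot> (e1 \<cdot> e4)) = 0"
    by (simp_all only: mul_scale_left mul_scale_right e1_e5 e3_e5 e3_e4 e4_e4 e4_e5 scale_scale
        mult.commute[of t] scale_zero_right)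
  have e6_zero: "x \<cdot> (t \<odot> ?q) = 0" for x
    using mul_P3_zero[OF dim_P3 q_P3] by (simp add: mul_linear)
  have sq: "p \<cdot> p' = 0" if "p \<in> {e1 \<cdot> e1, t \<odot> (e1 \<cdot> e4)}" "p' \<in> {e1 \<cdot> e1, t \<odot> (e1 \<cdot> e4)}" for p p'
    using that by (intro P2_mul_P2_zero[OF dim_P3]) (auto simp: subspace_scale)
  have e3_sq: "e3 \<cdot> e3 = ?\<delta> \<odot> (t \<odot> ?q)"
    by (simp add: d t_def)
  have "algebra_isomorphic smul (\<cdot>) (*s) (A2_6 \<beta> ?\<delta>)"
    by (rule isomorphic_A2_6I[OF dim_UNIV_6 span refl e1_e3 mul_scale_right table(1) mul_scale_right
          e3_sq table(2) cube_zero e3_e2 table(3-5) e6_zero sq])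
  then show ?thesis by (intro bexI[of _ ?\<delta>]) auto
qed

lemma functional_zero_on_span:
  assumes "span X = UNIV" and "\<And>x. x \<in> X \<Longrightarrow> \<theta> (x \<cdot> p) = 0"
  shows "\<theta> (a \<cdot> p) = 0"
  using mul_span_mem[OF subspace_functional_kernel, of X "{p}" a p] assms
  by (auto simp: span_base)

text \<open>
  As \<open>w\<close> is invisible to the form, there is a pair \<open>x, y\<close> adapted to the form with \<open>W\<close> spanned by \<open>w\<close> and \<open>A\<^sup>2\<close>, and
  then \<open>yy \<in> A\<^sup>3\<close>. A multiple of \<open>xx\<close> added to \<open>y\<close> makes its square zero; multiples of \<open>xx\<close> and \<open>xy\<close> added to
  \<open>w\<close> make it annihilate \<open>x\<close> and \<open>y\<close>. Nothing else is disturbed, because \<open>w A\<^sup>2 = 0\<close> and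
  \<open>A\<^sup>2 A\<^sup>2 = 0\<close>. The result is \<open>x = e\<^sub>1\<close>, \<open>w = e\<^sub>3\<close>, \<open>y = e\<^sub>4\<close>.
\<close>

lemma isomorphic_A2_6_0:
  assumes gen: "span (insert u (insert v (insert w P2))) = UNIV"
    and w: "\<And>p. p \<in> P2 \<Longrightarrow> w \<cdot> p = 0" and ww: "\<And>a b. (w \<cdot> a) \<cdot> b = 0"
  shows "\<exists>\<delta>\<in>{0, 1}. algebra_isomorphic smul (\<cdot>) (*s) (A2_6 0 \<delta>)"
proof -
  let ?W = "insert w P2"
  have wa: "w \<cdot> a \<in> P3" for a
    using ww by (intro P2_annihilator_in_P3) (simp_all add: mul_commute[of _ "w \<cdot> a"] functional_simps)
  have W1: "\<theta> (w' \<cdot> (a \<cdot> b)) = 0" if "w' \<in> ?W" for w' a b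
    using that w functional_P2_P2 by (auto simp: functional_simps)
  have W2: "\<theta> (a \<cdot> (w' \<cdot> b)) = 0" if "w' \<in> ?W" for w' a b
    using that wa functional_mul_P3 by auto
  obtain x y where gen: "span (insert x (insert y ?W)) = UNIV"
    and zero: "\<theta> (y \<cdot> (x \<cdot> y)) = 0" and nonzero: "\<theta> (x \<cdot> (x \<cdot> y)) \<noteq> 0"
    using exists_adapted_pair[OF gen W1 W2] by blast
  define A where "A = \<theta> (x \<cdot> (x \<cdot> y))"
  have A: "A \<noteq> 0" using nonzero by (simp add: A_def)
  have x_yy: "\<theta> (x \<cdot> (y \<cdot> y)) = 0"
    using zero functional_square_mul[of x y] by (simp add: mul_commute[of x y])
  have y_xx: "\<theta> (y \<cdot> (x \<cdot> x)) = - 2 * A"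
    using functional_square_mul[of y x] by (simp add: A_def)
  have "\<theta> (a \<cdot> (y \<cdot> y)) = 0" for a
    by (rule functional_zero_on_span[OF gen]) (use x_yy W1 in \<open>auto simp: cube_zero functional_simps\<close>)
  then have yy: "y \<cdot> y \<in> P3" by (intro P2_annihilator_in_P3) simp_all
  \<comment> \<open>The square of \<open>y + \<kappa> xx\<close> is \<open>yy + 2\<kappa> y(xx)\<close>, and \<open>\<theta>(y(xx)) = - 2A\<close>.\<close>
  define \<kappa> where "\<kappa> = \<theta> (y \<cdot> y) / (4 * A)"
  define z where "z = y + \<kappa> \<odot> (x \<cdot> x)"
  have xx_xx: "(x \<cdot> x) \<cdot> (x \<cdot> x) = 0" by (intro P2_mul_P2_zero[OF dim_P3]) simp_all
  have xz: "x \<cdot> z = x \<cdot> y" by (simp add: z_def mul_linear cube_zero)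
  have wz: "w \<cdot> z = w \<cdot> y" by (simp add: z_def mul_linear w)
  have zz_eq: "z \<cdot> z = y \<cdot> y + (2 * \<kappa>) \<odot> (y \<cdot> (x \<cdot> x))"
    using scale_left_distrib[of \<kappa> \<kappa>]
    by (simp add: z_def mul_linear xx_xx mul_commute[of "x \<cdot> x" y])
  have zz: "z \<cdot> z = 0"
  proof (rule P3_eq_zeroI[OF dim_P3])
    show "z \<cdot> z \<in> P3" using yy by (simp add: zz_eq subspace_add subspace_scale)
    show "\<theta> (z \<cdot> z) = 0"
      using A four_neq_zero[OF two_neq_zero] two_neq_zero by (simp add: zz_eq functional_simps y_xx \<kappa>_def)
  qed
  \<comment> \<open>Adding \<open>s xx + r xy\<close> to \<open>w\<close> changes \<open>\<theta>(wx)\<close> by \<open>rA\<close> and \<open>\<theta>(wz)\<close> by \<open>- 2sA\<close>.\<close>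
  define s where "s = \<theta> (w \<cdot> y) / (2 * A)"
  define r where "r = - \<theta> (w \<cdot> x) / A"
  define e3 where "e3 = w + (s \<odot> (x \<cdot> x) + r \<odot> (x \<cdot> y))"
  have p: "s \<odot> (x \<cdot> x) + r \<odot> (x \<cdot> y) \<in> P2" by (simp add: subspace_add subspace_scale)
  have e3_P2: "e3 \<cdot> q = 0" if "q \<in> P2" for q
    using that p by (simp add: e3_def mul_linear w P2_mul_P2_zero[OF dim_P3])
  have e3_x: "e3 \<cdot> x = 0"
  proof (rule P3_eq_zeroI[OF dim_P3])
    show "e3 \<cdot> x \<in> P3"
      unfolding e3_def mul_add_left[of w] by (intro subspace_add subspace_products wa mul_in_products' p)
    have "e3 \<cdot> x = w \<cdot> x + r \<odot> (x \<cdot> (x \<cdot> y))"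
      by (simp add: e3_def mul_add_left mul_scale_left mul_commute[of "x \<cdot> x" x]
          mul_commute[of "x \<cdot> y" x] cube_zero)
    then show "\<theta> (e3 \<cdot> x) = 0"
      using A by (simp add: functional_simps A_def[symmetric]) (simp add: r_def)
  qed
  have e3_z: "e3 \<cdot> z = 0"
  proof (rule P3_eq_zeroI[OF dim_P3])
    have "e3 \<cdot> z = w \<cdot> y + (s \<odot> (x \<cdot> x) + r \<odot> (x \<cdot> y)) \<cdot> z"
      unfolding e3_def mul_add_left[of w] wz ..
    then show "e3 \<cdot> z \<in> P3" using wa[of y] p by (simp add: subspace_add)
    have "(x \<cdot> y) \<cdot> z = y \<cdot> (x \<cdot> y)" "(x \<cdot> x) \<cdot> z = y \<cdot> (x \<cdot> x)"
      using P2_mul_P2_zero[OF dim_P3, of "x \<cdot> y" "x \<cdot> x"] xx_xx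
      by (simp_all add: z_def mul_linear mul_commute[of "x \<cdot> x" y]
          mul_commute[of "x \<cdot> y" y])
    then have "e3 \<cdot> z = w \<cdot> y + s \<odot> (y \<cdot> (x \<cdot> x)) + r \<odot> (y \<cdot> (x \<cdot> y))"
      by (simp add: e3_def mul_add_left mul_scale_left wz)
    then show "\<theta> (e3 \<cdot> z) = 0"
      using A two_neq_zero by (simp add: functional_simps y_xx zero s_def)
  qed
  have e3_e3: "e3 \<cdot> e3 \<in> P3"
  proof -
    let ?p = "s \<odot> (x \<cdot> x) + r \<odot> (x \<cdot> y)"
    have "e3 \<cdot> e3 = w \<cdot> e3 + ?p \<cdot> e3"
      by (subst (1) e3_def) (rule mul_add_left)
    also have "?p \<cdot> e3 = 0"
      using e3_P2[OF p] by (simp only: mul_commute[of ?p e3])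
    also have "w \<cdot> e3 = w \<cdot> w"
      unfolding e3_def mul_add_right[of w w] w[OF p] by simp
    finally have "e3 \<cdot> e3 = w \<cdot> w" by simp
    then show ?thesis using wa by simp
  qed
  have "span (insert x (insert e3 (insert z P2))) = UNIV" (is "span ?X = UNIV")
  proof (rule span_eq_UNIV_trans[OF gen])
    have P2: "P2 \<subseteq> span ?X" by (auto intro: span_base)
    have "y \<in> span ?X"
      by (rule span_add_cancel[of y "\<kappa> \<odot> (x \<cdot> x)"]) (use P2 in \<open>auto simp: z_def[symmetric] intro!: span_base span_scale\<close>)
    moreover have "w \<in> span ?X"
      by (rule span_add_cancel[of w "s \<odot> (x \<cdot> x) + r \<odot> (x \<cdot> y)"]) (use P2 p in \<open>auto simp: e3_def[symmetric] intro: span_base\<close>)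
    ultimately show "insert x (insert y ?W) \<subseteq> span ?X"
      using P2 by (auto intro: span_base)
  qed
  moreover have "(x \<cdot> x) \<cdot> z \<noteq> 0"
  proof
    assume "(x \<cdot> x) \<cdot> z = 0"
    then have "x \<cdot> (x \<cdot> z) = 0" by (simp add: mul_mul_self)
    then show False using nonzero by (simp add: xz functional_simps)
  qed
  ultimately show ?thesis
    using e3_x e3_z zz e3_P2 e3_e3
    by (intro isomorphic_A2_6_if_adapted_triple[of x e3 z 0]) (simp_all add: mul_commute[of x e3])
qed


context
  fixes w :: 'a
  assumes w: "\<And>p. p \<in> P2 \<Longrightarrow> w \<cdot> p = 0"
begin

text \<open>
  For \<open>w\<close> with \<open>w A\<^sup>2 = 0\<close> the product \<open>(wa)b\<close> is alternating in \<open>a\<close> and \<open>b\<close>, by the Jacobi identity. It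
  vanishes when \<open>a\<close> or \<open>b\<close> is \<open>w\<close> or lies in \<open>A\<^sup>2\<close>, hence it is determined by the single value \<open>(wu)v\<close> for
  any \<open>u, v\<close> that span \<open>A\<close> together with \<open>w\<close> and \<open>A\<^sup>2\<close>. Whether this value vanishes decides between \<open>\<beta> = 0\<close> and \<open>\<beta> = 1\<close>.
\<close>

lemma annihilator_mul_swap: "(w \<cdot> a) \<cdot> b = - ((w \<cdot> b) \<cdot> a)"
  using mul_mul_left[of w a b] w[of "a \<cdot> b"] by (simp add: mul_commute[of a "w \<cdot> b"])

lemma annihilator_mul_self: "(w \<cdot> a) \<cdot> a = 0"
proof -
  have "(w \<cdot> a) \<cdot> a + (w \<cdot> a) \<cdot> a = 0"
    using annihilator_mul_swap[of a a] by (simp add: eq_neg_iff_add_eq_0)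
  then show ?thesis using double_eq_zero_iff by blast
qed

lemma mul_annihilator_square: "a \<cdot> (w \<cdot> w) = 0"
  using annihilator_mul_swap[of w a] w[of "w \<cdot> a"]
  by (simp add: mul_commute[of a "w \<cdot> w"] mul_commute[of "w \<cdot> a" w])

lemma in_P3_if_span:
  assumes gen: "span (insert u (insert v (insert w P2))) = UNIV"
    and "p \<in> P2" and "\<theta> (u \<cdot> p) = 0" and "\<theta> (v \<cdot> p) = 0"
  shows "p \<in> P3"
proof (rule P2_annihilator_in_P3[OF assms(2)])
  show "\<theta> (a \<cdot> p) = 0" for a
    by (rule functional_zero_on_span[OF gen])
      (use assms w functional_P2_P2 in \<open>auto simp: functional_simps\<close>)
qed

text \<open>
  Since \<open>ww\<close> is annihilated by everything, adding \<open>\<kappa> w\<close> to \<open>u\<close> changes \<open>uu\<close> by \<open>2\<kappa> wu\<close> up to elements of \<open>A\<^sup>3\<close>,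
  and similarly for \<open>v\<close>. Up to \<open>A\<^sup>3\<close>, elements of \<open>A\<^sup>2\<close> are recognised by their products with \<open>u\<close> and \<open>v\<close>;
  as \<open>u(uu) = 0\<close> and \<open>v(vv) = 0\<close>, one scalar equation each determines \<open>\<kappa>\<close> and \<open>\<mu>\<close>.
\<close>

lemma exists_normalised_pair:
  assumes gen: "span (insert u (insert v (insert w P2))) = UNIV" and neq: "(w \<cdot> u) \<cdot> v \<noteq> 0"
  obtains u' v' where "span (insert u' (insert v' (insert w P2))) = UNIV" and "\<theta> (v' \<cdot> (w \<cdot> u')) \<noteq> 0"
    and "u' \<cdot> u' - w \<cdot> u' \<in> P3" and "v' \<cdot> v' \<in> P3"
proof -
  define Q where "Q = \<theta> (v \<cdot> (w \<cdot> u))"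
  have "v \<cdot> (w \<cdot> u) \<noteq> 0" using neq by (simp add: mul_commute[of v])
  then have Q: "Q \<noteq> 0"
    using P3_eq_zeroI[OF dim_P3, of "v \<cdot> (w \<cdot> u)"] by (auto simp: Q_def)
  have u_wv: "\<theta> (u \<cdot> (w \<cdot> v)) = - Q"
    using annihilator_mul_swap[of v u]
    by (simp add: Q_def mul_commute[of u "w \<cdot> v"] mul_commute[of v "w \<cdot> u"] functional_simps)
  have u_wu: "u \<cdot> (w \<cdot> u) = 0" and v_wv: "v \<cdot> (w \<cdot> v) = 0"
    using annihilator_mul_self by (simp_all add: mul_commute[of _ "w \<cdot> _"])
  define \<kappa> where "\<kappa> = (1 - \<theta> (v \<cdot> (u \<cdot> u)) / Q) / 2"
  define \<mu> where "\<mu> = \<theta> (u \<cdot> (v \<cdot> v)) / (2 * Q)"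
  define u' where "u' = u + \<kappa> \<odot> w"
  define v' where "v' = v + \<mu> \<odot> w"
  have wu': "w \<cdot> u' = w \<cdot> u + \<kappa> \<odot> (w \<cdot> w)"
    by (simp add: u'_def mul_add_right mul_scale_right)
  have uu': "u' \<cdot> u' = u \<cdot> u + (2 * \<kappa>) \<odot> (w \<cdot> u) + (\<kappa> * \<kappa>) \<odot> (w \<cdot> w)"
    using scale_left_distrib[of \<kappa> \<kappa> "w \<cdot> u"]
    by (simp add: u'_def mul_add_left mul_add_right mul_scale_left mul_scale_right
          scale_right_distrib mul_commute[of u w])
  have vv': "v' \<cdot> v' = v \<cdot> v + (2 * \<mu>) \<odot> (w \<cdot> v) + (\<mu> * \<mu>) \<odot> (w \<cdot> w)"
    using scale_left_distrib[of \<mu> \<mu> "w \<cdot> v"]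
    by (simp add: v'_def mul_add_left mul_add_right mul_scale_left mul_scale_right
          scale_right_distrib mul_commute[of v w])
  have "u' \<cdot> u' - w \<cdot> u' \<in> P3"
  proof (rule in_P3_if_span[OF gen])
    show "u' \<cdot> u' - w \<cdot> u' \<in> P2" by (simp add: subspace_diff)
    show "\<theta> (u \<cdot> (u' \<cdot> u' - w \<cdot> u')) = 0"
      by (simp only: uu' wu' mul_diff_right mul_add_right mul_scale_right mul_annihilator_square
          u_wu cube_zero functional_simps) simp
    have "2 * \<kappa> * Q = Q - \<theta> (v \<cdot> (u \<cdot> u))"
      using Q two_neq_zero by (simp add: \<kappa>_def field_simps)
    then show "\<theta> (v \<cdot> (u' \<cdot> u' - w \<cdot> u')) = 0"
      by (simp only: uu' wu' mul_diff_right mul_add_right mul_scale_right mul_annihilator_square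
          functional_simps Q_def[symmetric]) simp
  qed
  moreover have "v' \<cdot> v' \<in> P3"
  proof (rule in_P3_if_span[OF gen])
    show "\<theta> (v \<cdot> (v' \<cdot> v')) = 0"
      by (simp only: vv' mul_add_right mul_scale_right mul_annihilator_square v_wv cube_zero functional_simps) simp
    have "2 * \<mu> * Q = \<theta> (u \<cdot> (v \<cdot> v))"
      using Q two_neq_zero by (simp add: \<mu>_def field_simps)
    then show "\<theta> (u \<cdot> (v' \<cdot> v')) = 0"
      by (simp only: vv' mul_add_right mul_scale_right mul_annihilator_square u_wv functional_simps) simp
  qed simp
  moreover have "v' \<cdot> (w \<cdot> u') = v \<cdot> (w \<cdot> u)"
  proof -
    have "v' \<cdot> (w \<cdot> u') = v' \<cdot> (w \<cdot> u)"
      by (simp add: wu' mul_add_right mul_scale_right mul_annihilator_square)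
    also have "\<dots> = v \<cdot> (w \<cdot> u)"
      using w[of "w \<cdot> u"] by (simp add: v'_def mul_add_left mul_scale_left)
    finally show ?thesis .
  qed
  then have "\<theta> (v' \<cdot> (w \<cdot> u')) \<noteq> 0" using Q by (simp add: Q_def)
  moreover have "span (insert u' (insert v' (insert w P2))) = UNIV" (is "span ?X = UNIV")
  proof (rule span_eq_UNIV_trans[OF gen])
    have w_X: "w \<in> span ?X" by (simp add: span_base)
    have "u \<in> span ?X"
      by (rule span_add_cancel[of u "\<kappa> \<odot> w"]) (simp_all add: u'_def[symmetric] span_base span_scale)
    moreover have "v \<in> span ?X"
      by (rule span_add_cancel[of v "\<mu> \<odot> w"]) (simp_all add: v'_def[symmetric] span_base span_scale)
    ultimately show "insert u (insert v (insert w P2)) \<subseteq> span ?X"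
      by (auto intro: span_base)
  qed
  ultimately show thesis using that by blast
qed

text \<open>
  In \<open>A\<^bsub>2,6\<^esub>(1,\<delta>)\<close> the vector \<open>w = 2 e\<^sub>1 + e\<^sub>3\<close> annihilates \<open>A\<^sup>2\<close> and satisfies \<open>w e\<^sub>1 = e\<^sub>1 e\<^sub>1\<close> and
  \<open>w e\<^sub>4 = 2 e\<^sub>1 e\<^sub>4\<close>. For a normalised pair these two equations and \<open>e\<^sub>4 e\<^sub>4 = 0\<close> hold modulo \<open>A\<^sup>3\<close>, with
  \<open>u = e\<^sub>1\<close>, \<open>v = e\<^sub>4\<close>. Multiples of \<open>wu\<close> and \<open>wv\<close> added to \<open>v\<close> and \<open>w\<close> make them exact, and then \<open>e\<^sub>3\<close> is recovered
  as \<open>w - 2u\<close>.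
\<close>

lemma isomorphic_A2_6_1:
  assumes "span (insert u0 (insert v0 (insert w P2))) = UNIV" and "(w \<cdot> u0) \<cdot> v0 \<noteq> 0"
  shows "\<exists>\<delta>\<in>{0, 1}. algebra_isomorphic smul (\<cdot>) (*s) (A2_6 1 \<delta>)"
proof -
  obtain u v where gen: "span (insert u (insert v (insert w P2))) = UNIV"
    and neq: "\<theta> (v \<cdot> (w \<cdot> u)) \<noteq> 0" and uu: "u \<cdot> u - w \<cdot> u \<in> P3" and vv: "v \<cdot> v \<in> P3"
    by (rule exists_normalised_pair[OF assms])
  define Q where "Q = \<theta> (v \<cdot> (w \<cdot> u))"
  have Q: "Q \<noteq> 0" using neq by (simp add: Q_def)
  have u_wv: "\<theta> (u \<cdot> (w \<cdot> v)) = - Q"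
    using annihilator_mul_swap[of v u]
    by (simp add: Q_def mul_commute[of u "w \<cdot> v"] mul_commute[of v "w \<cdot> u"] functional_simps)
  have u_wu: "u \<cdot> (w \<cdot> u) = 0" and v_wv: "v \<cdot> (w \<cdot> v) = 0"
    using annihilator_mul_self by (simp_all add: mul_commute[of _ "w \<cdot> _"])
  have v_uu: "\<theta> (v \<cdot> (u \<cdot> u)) = Q"
    using functional_mul_P3[OF uu, of v] by (simp add: mul_diff_right functional_simps Q_def)
  have u_uv: "2 * \<theta> (u \<cdot> (u \<cdot> v)) = - Q"
    using functional_square_mul[of v u] by (simp add: v_uu)
  have v_uv: "\<theta> (v \<cdot> (u \<cdot> v)) = 0"
    using functional_square_mul[of u v] functional_mul_P3[OF vv, of u] two_neq_zero
    by (simp add: mul_commute[of u v])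
  have uv: "2 \<odot> (u \<cdot> v) - w \<cdot> v \<in> P3"
  proof (rule in_P3_if_span[OF gen])
    show "2 \<odot> (u \<cdot> v) - w \<cdot> v \<in> P2" by (simp add: subspace_diff subspace_scale)
    show "\<theta> (u \<cdot> (2 \<odot> (u \<cdot> v) - w \<cdot> v)) = 0"
      by (simp add: mul_diff_right mul_scale_right functional_simps u_uv u_wv)
    show "\<theta> (v \<cdot> (2 \<odot> (u \<cdot> v) - w \<cdot> v)) = 0"
      by (simp add: mul_diff_right mul_scale_right functional_simps v_uv v_wv)
  qed
  let ?p = "w \<cdot> u" and ?r = "w \<cdot> v"
  have p_p: "?p \<cdot> ?p = 0" and r_p: "?r \<cdot> ?p = 0"
    by (simp_all add: P2_mul_P2_zero[OF dim_P3])
  \<comment> \<open>Adding \<open>\<nu> wu\<close> to \<open>v\<close> changes \<open>\<theta>(vv)\<close> by \<open>2\<nu> Q\<close>.\<close>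
  define \<nu> where "\<nu> = - \<theta> (v \<cdot> v) / (2 * Q)"
  define z where "z = v + \<nu> \<odot> ?p"
  have wz: "w \<cdot> z = ?r" by (simp add: z_def mul_add_right mul_scale_right w)
  have uz: "u \<cdot> z = u \<cdot> v" by (simp add: z_def mul_add_right mul_scale_right u_wu)
  have mul_z: "q \<cdot> z = q \<cdot> v" if "q \<in> P2" for q
    using that by (simp add: z_def mul_add_right mul_scale_right P2_mul_P2_zero[OF dim_P3])
  have zz: "z \<cdot> z = 0"
  proof (rule P3_eq_zeroI[OF dim_P3])
    have eq: "z \<cdot> z = v \<cdot> v + (2 * \<nu>) \<odot> (v \<cdot> ?p)"
      using scale_left_distrib[of \<nu> \<nu> "v \<cdot> ?p"]
      by (simp add: z_def mul_add_left mul_add_right mul_scale_left mul_scale_right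
          scale_right_distrib p_p mul_commute[of ?p v])
    show "z \<cdot> z \<in> P3" using vv by (simp add: eq subspace_add subspace_scale)
    show "\<theta> (z \<cdot> z) = 0"
      using Q two_neq_zero by (simp add: eq functional_simps Q_def[symmetric] \<nu>_def)
  qed
  \<comment> \<open>Adding \<open>s wu + t wv\<close> to \<open>w\<close> changes \<open>\<theta>(wu)\<close> by \<open>- tQ\<close> and \<open>\<theta>(wz)\<close> by \<open>sQ\<close>.\<close>
  define t where "t = \<theta> (?p - u \<cdot> u) / Q"
  define s where "s = \<theta> (2 \<odot> (u \<cdot> v) - ?r) / Q"
  define h where "h = s \<odot> ?p + t \<odot> ?r"
  define w' where "w' = w + h"
  have h_P2: "h \<in> P2" by (simp add: h_def subspace_add subspace_scale)
  have w'_P2: "w' \<cdot> q = 0" if "q \<in> P2" for q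
    using that h_P2 by (simp add: w'_def mul_add_left w P2_mul_P2_zero[OF dim_P3])
  have w'_u: "w' \<cdot> u = u \<cdot> u"
  proof -
    have eq: "w' \<cdot> u = ?p + t \<odot> (?r \<cdot> u)"
      by (simp add: w'_def h_def mul_add_left mul_scale_left annihilator_mul_self)
    have "u \<cdot> u - w' \<cdot> u = (u \<cdot> u - ?p) - t \<odot> (?r \<cdot> u)"
      by (simp add: eq)
    moreover have "(u \<cdot> u - ?p) - t \<odot> (?r \<cdot> u) = 0"
    proof (rule P3_eq_zeroI[OF dim_P3])
      show "(u \<cdot> u - ?p) - t \<odot> (?r \<cdot> u) \<in> P3" using uu by (simp add: subspace_diff subspace_scale)
      show "\<theta> ((u \<cdot> u - ?p) - t \<odot> (?r \<cdot> u)) = 0"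
        using Q u_wv by (simp add: functional_simps t_def mul_commute[of ?r u])
    qed
    ultimately show ?thesis by simp
  qed
  have w'_z: "w' \<cdot> z = 2 \<odot> (u \<cdot> z)"
  proof -
    have eq: "w' \<cdot> z = ?r + s \<odot> (v \<cdot> ?p)"
      by (simp add: w'_def h_def mul_add_left mul_scale_left wz mul_z annihilator_mul_self mul_commute[of ?p v])
    have "(2 \<odot> (u \<cdot> v) - ?r) - s \<odot> (v \<cdot> ?p) = 0"
    proof (rule P3_eq_zeroI[OF dim_P3])
      show "(2 \<odot> (u \<cdot> v) - ?r) - s \<odot> (v \<cdot> ?p) \<in> P3" using uv by (simp add: subspace_diff subspace_scale)
      show "\<theta> ((2 \<odot> (u \<cdot> v) - ?r) - s \<odot> (v \<cdot> ?p)) = 0"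
        using Q by (simp add: functional_simps s_def Q_def[symmetric])
    qed
    then show ?thesis by (simp add: eq uz algebra_simps)
  qed
  have w'_w': "w' \<cdot> w' = w \<cdot> w"
  proof -
    have "w' \<cdot> w' = w' \<cdot> w + w' \<cdot> h" by (subst (2) w'_def) (rule mul_add_right)
    also have "w' \<cdot> h = 0" by (rule w'_P2[OF h_P2])
    also have "w' \<cdot> w = w \<cdot> w + h \<cdot> w" unfolding w'_def by (rule mul_add_left)
    also have "h \<cdot> w = 0" using w[OF h_P2] by (simp only: mul_commute[of h w])
    finally show ?thesis by simp
  qed
  define e3 where "e3 = w' - 2 \<odot> u"
  have u_e3: "u \<cdot> e3 = (- 1) \<odot> (u \<cdot> u)"
    using scale_left_distrib[of 1 1 "u \<cdot> u"]
    by (simp add: e3_def mul_diff_right mul_scale_right mul_commute[of u w'] w'_u)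
  have e3_z: "e3 \<cdot> z = 0"
    by (simp add: e3_def mul_diff_left mul_scale_left w'_z)
  have e3_uu: "e3 \<cdot> (u \<cdot> u) = 0"
    by (simp add: e3_def mul_diff_left mul_scale_left w'_P2 cube_zero)
  have e3_uz: "e3 \<cdot> (u \<cdot> z) = 1 \<odot> ((u \<cdot> u) \<cdot> z)"
    by (simp add: e3_def mul_diff_left mul_scale_left w'_P2 square_mul_scale)
  have e3_e3: "e3 \<cdot> e3 \<in> P3"
  proof -
    have "e3 \<cdot> e3 = w' \<cdot> e3 - 2 \<odot> (u \<cdot> e3)"
      by (subst (1) e3_def) (simp only: mul_diff_left mul_scale_left)
    also have "w' \<cdot> e3 = w \<cdot> w - 2 \<odot> (u \<cdot> u)"
      by (simp add: e3_def mul_diff_right mul_scale_right w'_w' w'_u)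
    finally have "e3 \<cdot> e3 = w \<cdot> w" by (simp add: u_e3)
    moreover have "w \<cdot> w \<in> P3"
      by (rule in_P3_if_span[OF gen]) (simp_all add: mul_annihilator_square functional_simps)
    ultimately show ?thesis by simp
  qed
  have "\<theta> ((u \<cdot> u) \<cdot> z) = Q"
    by (simp add: mul_z v_uu mul_commute[of "u \<cdot> u" v])
  then have e6: "(u \<cdot> u) \<cdot> z \<noteq> 0" using Q by (auto simp: functional_simps)
  have "span (insert u (insert e3 (insert z P2))) = UNIV" (is "span ?X = UNIV")
  proof (rule span_eq_UNIV_trans[OF gen])
    have P2: "q \<in> span ?X" if "q \<in> P2" for q using that by (simp add: span_base)
    have u_X: "u \<in> span ?X" by (simp add: span_base)
    have "v \<in> span ?X"
    proof (rule span_add_cancel)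
      show "v + \<nu> \<odot> ?p \<in> span ?X" by (simp add: z_def[symmetric] span_base)
      show "\<nu> \<odot> ?p \<in> span ?X" by (simp add: P2 span_scale)
    qed
    moreover have "w \<in> span ?X"
    proof (rule span_add_cancel)
      have "w + h = e3 + 2 \<odot> u" by (simp add: e3_def w'_def)
      then show "w + h \<in> span ?X" using u_X by (simp add: span_add span_scale span_base)
      show "h \<in> span ?X" using P2 h_P2 by blast
    qed
    ultimately show "insert u (insert v (insert w P2)) \<subseteq> span ?X"
      using u_X P2 by blast
  qed
  then show ?thesis
    by (rule isomorphic_A2_6_if_adapted_triple[OF _ u_e3 e3_z zz e3_uu e3_uz e3_e3 e6])
qed

lemma annihilator_mul_mul_zero:
  assumes gen: "span (insert u (insert v (insert w P2))) = UNIV" and zero: "(w \<cdot> u) \<cdot> v = 0"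
  shows "(w \<cdot> a) \<cdot> b = 0"
proof -
  let ?X = "insert u (insert v (insert w P2))"
  have pair: "(w \<cdot> x) \<cdot> y = 0" if "x \<in> P2 \<or> y \<in> P2 \<or> y = w" for x y
    using that w mul_commute[of "w \<cdot> x" w] by (auto simp: P2_mul_P2_zero[OF dim_P3])
  have X: "y \<cdot> (w \<cdot> x) = 0" if "x \<in> ?X" "y \<in> ?X" for x y
  proof -
    have "(w \<cdot> x) \<cdot> y = 0"
      using that zero pair annihilator_mul_self annihilator_mul_swap[of x y] by auto
    then show ?thesis by (simp add: mul_commute[of y])
  qed
  have X': "x \<cdot> (w \<cdot> b) = 0" if "x \<in> ?X" for x b
  proof -
    have sub: "subspace {z. z \<cdot> (w \<cdot> x) = 0}"
      by (auto intro!: subspaceI simp: mul_linear)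
    have "b \<in> span ?X" using gen by simp
    then have "b \<in> {z. z \<cdot> (w \<cdot> x) = 0}"
      using span_minimal[OF _ sub, of ?X] X[OF that] by blast
    then show ?thesis
      using annihilator_mul_swap[of x b] by (simp add: mul_commute[of b] mul_commute[of x "w \<cdot> b"])
  qed
  have sub: "subspace {z. z \<cdot> (w \<cdot> a) = 0}"
    by (auto intro!: subspaceI simp: mul_linear)
  have "b \<in> span ?X" using gen by simp
  then have "b \<in> {z. z \<cdot> (w \<cdot> a) = 0}"
    using span_minimal[OF _ sub, of ?X] X' by blast
  then show ?thesis by (simp add: mul_commute[of _ b])
qed

end

lemma isomorphic_A2_6_if_dim_P2_3:
  "\<exists>\<beta>\<in>{0, 1}. \<exists>\<delta>\<in>{0, 1}. algebra_isomorphic smul (\<cdot>) (*s) (A2_6 \<beta> \<delta>)"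
proof -
  obtain w where w: "w \<notin> P2" "\<And>p. p \<in> P2 \<Longrightarrow> w \<cdot> p = 0"
    using exists_annihilator by blast
  have "dim (span (insert w P2)) + 2 = dim (UNIV :: 'a set)"
    using w(1) dim_UNIV_6 dim_P2 by (simp add: dim_insert span_eq_iff[THEN iffD2])
  then obtain u v where "span (insert u (insert v (span (insert w P2)))) = UNIV"
    using exists_span_insert_two[of "span (insert w P2)"] by auto
  then have gen: "span (insert u (insert v (insert w P2))) = UNIV"
    by (rule span_eq_UNIV_trans) (auto intro: span_base subsetD[OF span_mono, rotated])
  show ?thesis
  proof (cases "(w \<cdot> u) \<cdot> v = 0")
    case True
    have "(w \<cdot> a) \<cdot> b = 0" for a b
      by (rule annihilator_mul_mul_zero[OF w(2) gen True])
    then show ?thesis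
      using isomorphic_A2_6_0[OF gen w(2)] by blast
  next
    case False
    then show ?thesis
      using isomorphic_A2_6_1[OF w(2) gen] by blast
  qed
qed

end

end

section \<open>The classification\<close>

theorem isomorphic_to_classification_list:
  assumes "\<not> associative (\<cdot>)" and dim: "dim (UNIV :: 'a set) = 6"
  shows "\<exists>B\<in>set classification_list. algebra_isomorphic smul (\<cdot>) (*s) B"
proof -
  obtain \<theta> where \<theta>: "cubic_functional \<theta>"
    using exists_cubic_functional[OF assms(1)] .
  have "dim P2 = 3 \<or> dim P2 = 4"
    using dim_P2_ge[OF \<theta>] dim_UNIV_ge[OF \<theta>] dim_P3_pos[OF \<theta>] dim by linarith
  then show ?thesis
  proof
    assume "dim P2 = 3"
    then show ?thesis
      using isomorphic_A2_6_if_dim_P2_3[OF \<theta> dim] by (auto simp: classification_list_def)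
  next
    assume "dim P2 = 4"
    then show ?thesis
      using isomorphic_A1_6_if_dim_P2_4[OF \<theta> dim] by (simp add: classification_list_def)
  qed
qed

end

theorem proposition5p1:
  assumes "CHAR('k::alg_closed_field) \<noteq> 2" and "CHAR('k) \<noteq> 3"
  shows "(\<forall>(smul :: 'k \<Rightarrow> 'a::ab_group_add \<Rightarrow> 'a) mul.
            jacobi_jordan_algebra smul mul \<and> vector_space.dim smul (UNIV :: 'a set) = 6 \<and>
            \<not> associative mul \<longrightarrow>
            (\<exists>!n. n < length (classification_list :: ('k ^ 6 \<Rightarrow> 'k ^ 6 \<Rightarrow> 'k ^ 6) list) \<and>
                  algebra_isomorphic smul mul vector_scalar_mult (classification_list ! n))) \<and>
         (\<forall>B \<in> set (classification_list :: ('k ^ 6 \<Rightarrow> 'k ^ 6 \<Rightarrow> 'k ^ 6) list).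
            jacobi_jordan_algebra vector_scalar_mult B \<and> \<not> associative B) \<and>
         vec.dim (algebra_square vector_scalar_mult (A1_6 :: 'k ^ 6 \<Rightarrow> _)) = 4 \<and>
         (\<forall>\<beta> \<in> {0, 1 :: 'k}. \<forall>\<delta> \<in> {0, 1}.
            vec.dim (algebra_square vector_scalar_mult (A2_6 \<beta> \<delta>)) = 3)"
proof -
  have neq: "(of_nat p :: 'k) \<noteq> 0" if "prime p" "CHAR('k) \<noteq> p" for p
  proof
    assume "(of_nat p :: 'k) = 0"
    then have "CHAR('k) dvd p" by (simp add: of_nat_eq_0_iff_char_dvd)
    then have "CHAR('k) = 1 \<or> CHAR('k) = p"
      using that(1) by (meson prime_nat_iff)
    then show False using that(2) CHAR_not_1' by auto
  qed
  have two: "(2 :: 'k) \<noteq> 0" and three: "(3 :: 'k) \<noteq> 0"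
    using neq[of 2] neq[of 3] assms by simp_all
  have "\<exists>!n. n < length (classification_list :: ('k ^ 6 \<Rightarrow> 'k ^ 6 \<Rightarrow> 'k ^ 6) list) \<and>
      algebra_isomorphic smul mul (*s) (classification_list ! n)"
    if jj: "jacobi_jordan_algebra smul mul" and dim: "vector_space.dim smul (UNIV :: 'a set) = 6"
      and nonassoc: "\<not> associative mul"
    for smul :: "'k \<Rightarrow> 'a \<Rightarrow> 'a" and mul
  proof -
    interpret jacobi_jordan_algebra smul mul by (rule jj)
    obtain B where B: "independent B" "span B = UNIV" "card B = 6"
      using basis_exists[of UNIV] dim by (metis top.extremum_uniqueI)
    interpret jj_algebra_findim smul mul B
      using B two three by unfold_locales (auto intro: card_ge_0_finite)
    obtain n where n: "n < length (classification_list :: ('k ^ 6 \<Rightarrow> 'k ^ 6 \<Rightarrow> 'k ^ 6) list)"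
        "algebra_isomorphic smul mul (*s) (classification_list ! n :: 'k ^ 6 \<Rightarrow> 'k ^ 6 \<Rightarrow> 'k ^ 6)"
      using isomorphic_to_classification_list[OF nonassoc dim] by (metis in_set_conv_nth)
    show ?thesis
    proof (rule ex1I)
      fix m assume "m < length (classification_list :: ('k ^ 6 \<Rightarrow> 'k ^ 6 \<Rightarrow> 'k ^ 6) list) \<and>
        algebra_isomorphic smul mul (*s) (classification_list ! m :: 'k ^ 6 \<Rightarrow> 'k ^ 6 \<Rightarrow> 'k ^ 6)"
      with n show "m = n"
        using algebra_isomorphic_trans algebra_isomorphic_sym
          classification_list_nonisomorphic[OF two refl] by blast
    qed (use n in blast)
  qed
  moreover have "jacobi_jordan_algebra (*s) B \<and> \<not> associative B"
    if "B \<in> set (classification_list :: ('k ^ 6 \<Rightarrow> 'k ^ 6 \<Rightarrow> 'k ^ 6) list)" for B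
    using that A1_6_jacobi_jordan[OF two] A2_6_jacobi_jordan[OF two]
      A1_6_not_associative[OF two three] A2_6_not_associative[OF two three]
    by (auto simp: classification_list_def)
  ultimately show ?thesis
    using dim_A1_6_square dim_A2_6_square by blast
qed

end
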